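(* Consider an environment $(F,B,\alpha)$ as described in the context (background-risk distribution $F$ with density $f$, compact asset menu $B\ni\mathbf 0$, MLR-ordered experiment $\alpha$). Suppose that the density $f$ is downward log convex and that $B$ is an insurance menu. Then willingness to pay for information is increasing with risk aversion: for all $u,v\in U$ such that $u$ is more risk averse than $v$ and both $u$ and $v$ satisfy (ZAZI), one has $M(u)\ge M(v)$.
   Context: Environment. $W$ is a real random variable (background wealth) whose CDF $F$ satisfies $\int|w|\,\mathrm dF(w)<\infty$ and admits a density $f:\mathbb R\to\mathbb R_+$. A map is $F$-integrable if it is measurable and $\int|\cdot|\,\mathrm dF<\infty$. $U$ is the set of strictly increasing functions $u:\mathbb R\to\mathbb R$ that are $F$-integrable, absolutely continuous on every bounded interval, and satisfy $\limsup_{m\to\infty}u(m)/m<\infty$. For $u,v\in U$, $v$ is more risk averse than $u$ if $v=\phi\circ u$ for some increasing and (weakly) concave $\phi:\mathbb R\to\mathbb R$ ("increasing" is in the strict sense). Assets. An asset is an $F$-integrable map $b:\mathbb R\to\mathbb R$. $B$ is a set of assets containing the status quo $\mathbf 0$ (the zero map) and compact for the $L^1(F)$ metric. Experiment. $\alpha=(X,(h_w)_{w\in\mathbb R})$ where $X\subset\mathbb R$ is a finite set, each $h_w$ is a probability mass function on $X$, $w\mapsto h_w(x)$ is measurable for each $x\in X$, and $\alpha$ is MLR-ordered: $h_w(x)h_{w'}(x')\ge h_w(x')h_{w'}(x)$ whenever $w\le w'$ and $x\le x'$. Every signal has positive probability: $h(x)=\int h_w(x)\,\mathrm dF(w)>0$.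 The posterior after $x$ has density $f_x(w)=h_w(x)f(w)/h(x)$ and CDF $F_x$. Strategies and willingness to pay. A strategy is $\beta=(\beta_x)_{x\in X}\in B^X$. For $\mu\ge0$, $G^\mu_\beta(m)=\sum_{x\in X}h(x)\int\mathbf 1_{\{w+\beta_x(w)-\mu\le m\}}\,\mathrm dF_x(w)$ is the CDF of terminal wealth. For each $u\in U$, $\mu\ge 0$, the integrals $\int u\,\mathrm dG^\mu_\beta$ exist in $\mathbb R\cup\{-\infty\}$ and $\max_{\beta\in B^X}\int u\,\mathrm dG^\mu_\beta$ is attained. $M(u)\in\mathbb R_+$ is the unique number such that $\max_{\beta}\int u\,\mathrm dG^\mu_\beta<\int u\,\mathrm dF$ for all $\mu>M(u)$ and $\max_{\beta}\int u\,\mathrm dG^\mu_\beta>\int u\,\mathrm dF$ for all $0\le\mu<M(u)$ (such a number exists and is unique). (ZAZI) for $u$: $\mathbf 0\in\arg\max_{b\in B}\int u(w+b(w))\,\mathrm dF(w)$. Insurance menu. An insurance is an asset $b$ that is nonincreasing and such that $w\mapsto w+b(w)$ is nondecreasing. $B$ is an insurance menu if each $b\in B$ is an insurance and there exist $w^*\in\mathbb R\cup\{\pm\infty\}$ and a complete ordering $\succeq$ of $B$ (a complete transitive binary relation) such that, for all $b,b'\in B$ with $b'\succeq b$: $b'(w)\ge b(w)$ for all real $w\le w^*$, and $b'(w)\le b(w)$ for all real $w\ge w^*$. Downward log convexity. A density $f$ is downward log convex if $S=\{w\in\mathbb R:f(w)>0\}$ is convex and unbounded below, and $\log f$ is convex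 on $S$. (Then $f$ has support $(-\infty,\omega]$ for some $\omega\in\mathbb R$.) *)

theory Defs
  imports "HOL-Probability.Probability"
begin

text \<open>
  Throughout, \<open>F\<close> is the distribution of background wealth, given as a probability measure on the
  real line, so that integration \<open>dF\<close> is integration with respect to the measure \<open>F\<close>.
\<close>

definition background_risk :: "real measure \<Rightarrow> (real \<Rightarrow> real) \<Rightarrow> bool" where
  "background_risk F f \<longleftrightarrow>
     real_distribution F \<and> integrable F (\<lambda>w. w) \<and>
     f \<in> borel_measurable borel \<and> (\<forall>w. 0 \<le> f w) \<and> F = density lborel (\<lambda>w. ennreal (f w))"

definition downward_log_convex :: "(real \<Rightarrow> real) \<Rightarrow> bool" where
  "downward_log_convex f \<longleftrightarrow>
     convex {w. f w > 0} \<and> \<not> bdd_below {w. f w > 0} \<and> convex_on {w. f w > 0} (\<lambda>w. ln (f w))"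

text \<open>
  The integral of a measurable function whose positive part has a finite integral; its value then
  lies in \<open>\<real> \<union> {-\<infinity>}\<close>.
\<close>

definition ext_integral :: "'a measure \<Rightarrow> ('a \<Rightarrow> real) \<Rightarrow> ereal" where
  "ext_integral M g =
     enn2ereal (\<integral>\<^sup>+ x. ennreal (g x) \<partial>M) - enn2ereal (\<integral>\<^sup>+ x. ennreal (- g x) \<partial>M)"


section \<open>Utility functions\<close>

definition abs_cont_on :: "real set \<Rightarrow> (real \<Rightarrow> real) \<Rightarrow> bool" where
  "abs_cont_on S g \<longleftrightarrow>
     (\<forall>\<epsilon>>0. \<exists>\<delta>>0. \<forall>(n::nat) a b.
        (\<forall>i<n. a i \<le> b i \<and> {a i..b i} \<subseteq> S) \<and>
        disjoint_family_on (\<lambda>i. {a i<..<b i}) {..<n} \<and>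
        (\<Sum>i<n. b i - a i) < \<delta>
        \<longrightarrow> (\<Sum>i<n. \<bar>g (b i) - g (a i)\<bar>) < \<epsilon>)"

definition utilities :: "real measure \<Rightarrow> (real \<Rightarrow> real) set" where
  "utilities F =
     {u. strict_mono u \<and> integrable F u \<and> (\<forall>c d. abs_cont_on {c..d} u) \<and>
         Limsup at_top (\<lambda>m. ereal (u m / m)) < \<infinity>}"

definition more_risk_averse :: "(real \<Rightarrow> real) \<Rightarrow> (real \<Rightarrow> real) \<Rightarrow> bool" where
  "more_risk_averse v u \<longleftrightarrow> (\<exists>\<phi>. strict_mono \<phi> \<and> concave_on UNIV \<phi> \<and> v = \<phi> \<circ> u)"


section \<open>Assets\<close>

definition asset :: "real measure \<Rightarrow> (real \<Rightarrow> real) \<Rightarrow> bool" where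
  "asset F b \<longleftrightarrow> integrable F b"

definition L1_dist :: "real measure \<Rightarrow> (real \<Rightarrow> real) \<Rightarrow> (real \<Rightarrow> real) \<Rightarrow> real" where
  "L1_dist F b c = (\<integral>w. \<bar>b w - c w\<bar> \<partial>F)"

text \<open>
  Assets are functions rather than equivalence classes, so \<open>L1_dist F\<close> is only a pseudometric; the
  topology of its open balls need not be Hausdorff. A set is compact in this topology iff its image
  in the quotient metric space is compact.
\<close>

definition L1_open :: "real measure \<Rightarrow> (real \<Rightarrow> real) set \<Rightarrow> bool" where
  "L1_open F A \<longleftrightarrow>
     A \<subseteq> Collect (asset F) \<and>
     (\<forall>b\<in>A. \<exists>r>0. \<forall>c. asset F c \<and> L1_dist F b c < r \<longrightarrow> c \<in> A)"

definition L1_topology :: "real measure \<Rightarrow> (real \<Rightarrow> real) topology" where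
  "L1_topology F = topology (L1_open F)"

lemma istopology_L1_open: "istopology (L1_open F)"
  unfolding istopology_def
proof (intro conjI allI impI)
  fix S T assume S: "L1_open F S" and T: "L1_open F T"
  have "\<exists>r>0. \<forall>c. asset F c \<and> L1_dist F b c < r \<longrightarrow> c \<in> S \<inter> T" if b: "b \<in> S \<inter> T" for b
  proof -
    obtain r where r: "r > 0" "\<And>c. asset F c \<Longrightarrow> L1_dist F b c < r \<Longrightarrow> c \<in> S"
      using S b unfolding L1_open_def by blast
    obtain s where s: "s > 0" "\<And>c. asset F c \<Longrightarrow> L1_dist F b c < s \<Longrightarrow> c \<in> T"
      using T b unfolding L1_open_def by blast
    from r s show ?thesis by (intro exI[of _ "min r s"]) auto
  qed
  then show "L1_open F (S \<inter> T)" using S unfolding L1_open_def by blast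
next
  fix \<K> assume "\<forall>K\<in>\<K>. L1_open F K"
  then show "L1_open F (\<Union>\<K>)" unfolding L1_open_def by (meson Sup_le_iff Union_iff)
qed

lemma openin_L1_topology: "openin (L1_topology F) = L1_open F"
  unfolding L1_topology_def by (rule topology_inverse'[OF istopology_L1_open])

lemma topspace_L1_topology: "topspace (L1_topology F) = Collect (asset F)"
proof -
  have *: "L1_open F (Collect (asset F))"
    unfolding L1_open_def using zero_less_one by blast
  have "A \<subseteq> Collect (asset F)" if "L1_open F A" for A
    using that unfolding L1_open_def by (rule conjunct1)
  with * show ?thesis unfolding topspace_def openin_L1_topology by blast
qed

definition asset_menu :: "real measure \<Rightarrow> (real \<Rightarrow> real) set \<Rightarrow> bool" where
  "asset_menu F B \<longleftrightarrow>
     B \<subseteq> Collect (asset F) \<and> (\<lambda>_. 0) \<in> B \<and> compactin (L1_topology F) B"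

definition insurance :: "real measure \<Rightarrow> (real \<Rightarrow> real) \<Rightarrow> bool" where
  "insurance F b \<longleftrightarrow> asset F b \<and> antimono b \<and> mono (\<lambda>w. w + b w)"

text \<open>In the following definition, \<open>R b' b\<close> stands for \<open>b' \<succeq> b\<close>.\<close>

definition insurance_menu :: "real measure \<Rightarrow> (real \<Rightarrow> real) set \<Rightarrow> bool" where
  "insurance_menu F B \<longleftrightarrow>
     (\<forall>b\<in>B. insurance F b) \<and>
     (\<exists>(w0::ereal) R.
        (\<forall>b\<in>B. \<forall>b'\<in>B. R b b' \<or> R b' b) \<and>
        (\<forall>b\<in>B. \<forall>b'\<in>B. \<forall>b''\<in>B. R b b' \<and> R b' b'' \<longrightarrow> R b b'') \<and>
        (\<forall>b\<in>B. \<forall>b'\<in>B. R b' b \<longrightarrow>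
           (\<forall>w. ereal w \<le> w0 \<longrightarrow> b' w \<ge> b w) \<and> (\<forall>w. ereal w \<ge> w0 \<longrightarrow> b' w \<le> b w)))"

definition ZAZI :: "real measure \<Rightarrow> (real \<Rightarrow> real) set \<Rightarrow> (real \<Rightarrow> real) \<Rightarrow> bool" where
  "ZAZI F B u \<longleftrightarrow>
     is_arg_max (\<lambda>b. ext_integral F (\<lambda>w. u (w + b w))) (\<lambda>b. b \<in> B) (\<lambda>_. 0)"


section \<open>Experiments\<close>

definition signal_prob :: "real measure \<Rightarrow> (real \<Rightarrow> real pmf) \<Rightarrow> real \<Rightarrow> real" where
  "signal_prob F h x = (\<integral>w. pmf (h w) x \<partial>F)"

definition MLR_experiment :: "real measure \<Rightarrow> real set \<Rightarrow> (real \<Rightarrow> real pmf) \<Rightarrow> bool" where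
  "MLR_experiment F X h \<longleftrightarrow>
     finite X \<and> (\<forall>w. set_pmf (h w) \<subseteq> X) \<and>
     (\<forall>x\<in>X. (\<lambda>w. pmf (h w) x) \<in> borel_measurable borel) \<and>
     (\<forall>w w'. \<forall>x\<in>X. \<forall>x'\<in>X. w \<le> w' \<and> x \<le> x' \<longrightarrow>
        pmf (h w) x * pmf (h w') x' \<ge> pmf (h w) x' * pmf (h w') x) \<and>
     (\<forall>x\<in>X. signal_prob F h x > 0)"

definition posterior :: "real measure \<Rightarrow> (real \<Rightarrow> real) \<Rightarrow> (real \<Rightarrow> real pmf) \<Rightarrow> real \<Rightarrow> real measure"
  where "posterior F f h x =
     density lborel (\<lambda>w. ennreal (pmf (h w) x * f w / signal_prob F h x))"


section \<open>Willingness to pay for information\<close>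

definition wealth_cdf ::
    "real measure \<Rightarrow> (real \<Rightarrow> real) \<Rightarrow> real set \<Rightarrow> (real \<Rightarrow> real pmf) \<Rightarrow>
     real \<Rightarrow> (real \<Rightarrow> real \<Rightarrow> real) \<Rightarrow> real \<Rightarrow> real" where
  "wealth_cdf F f X h \<mu> \<beta> m =
     (\<Sum>x\<in>X. signal_prob F h x * (\<integral>w. indicator {w. w + \<beta> x w - \<mu> \<le> m} w \<partial>posterior F f h x))"

text \<open>
  The function \<open>wealth_cdf F f X h \<mu> \<beta>\<close> is integrated against in the Lebesgue-Stieltjes sense, that
  is, with respect to its \<open>interval_measure\<close>. The supremum below is attained in the environments
  considered.
\<close>

definition max_expected_utility ::
    "real measure \<Rightarrow> (real \<Rightarrow> real) \<Rightarrow> (real \<Rightarrow> real) set \<Rightarrow> real set \<Rightarrow> (real \<Rightarrow> real pmf) \<Rightarrow>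
     (real \<Rightarrow> real) \<Rightarrow> real \<Rightarrow> ereal" where
  "max_expected_utility F f B X h u \<mu> =
     (SUP \<beta> \<in> X \<rightarrow>\<^sub>E B. ext_integral (interval_measure (wealth_cdf F f X h \<mu> \<beta>)) u)"

definition WTP ::
    "real measure \<Rightarrow> (real \<Rightarrow> real) \<Rightarrow> (real \<Rightarrow> real) set \<Rightarrow> real set \<Rightarrow> (real \<Rightarrow> real pmf) \<Rightarrow>
     (real \<Rightarrow> real) \<Rightarrow> real" where
  "WTP F f B X h u =
     (THE M. M \<ge> 0 \<and>
        (\<forall>\<mu>>M. max_expected_utility F f B X h u \<mu> < ext_integral F u) \<and>
        (\<forall>\<mu>. 0 \<le> \<mu> \<and> \<mu> < M \<longrightarrow> max_expected_utility F f B X h u \<mu> > ext_integral F u))"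

end

theory Submission
  imports Defs
begin

text \<open>
  Write \<open>u = \<phi> \<circ> v\<close> and suppose \<open>M u < \<mu> < M v\<close>, so that some strategy gives \<open>v\<close> more than the
  status quo at price \<open>\<mu>\<close>. If the pivot \<open>w\<^sup>*\<close> of the menu is infinite or beyond the support of \<open>f\<close>,
  then every asset has constant sign almost everywhere, so (ZAZI) leaves only nonpositive assets
  and \<open>M v = 0\<close>. Otherwise every asset is nonnegative below \<open>w\<^sup>*\<close> and nonpositive above it, and by
  the MLR order the strategy can be improved to one that buys less insurance after higher signals.

  For such a strategy with terminal wealth \<open>Y\<close>, put \<open>\<Delta> m = P (Y \<le> m) - P (W \<le> m)\<close>. Substituting
  \<open>w = m + s\<close> writes \<open>\<Delta> m / f m\<close> as an integral over \<open>s\<close> of the ratio \<open>f (m + s) / f m\<close>, weighted by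
  \<open>P (Y \<le> m | W = m + s) - 1 (s \<le> 0)\<close>. On \<open>m < w\<^sup>* - \<mu>\<close> both factors are monotone in \<open>m\<close>, by log convexity and
  by MLR, and the signs match so that \<open>\<Delta> / f\<close> is nondecreasing; for \<open>m \<ge> w\<^sup>* - \<mu>\<close> one has \<open>\<Delta> m \<ge> 0\<close>.
  Hence \<open>Y\<close> crosses \<open>W\<close> once, as a less risky variable does, and if \<open>v\<close> prefers \<open>Y\<close> to \<open>W\<close> then so
  does the concave transform \<open>u\<close>.
\<close>

section \<open>Continuity and growth of utility functions\<close>

lemma utility_continuous:
  assumes "u \<in> utilities F"
  shows "continuous_on UNIV u"
proof (rule continuous_at_imp_continuous_on, intro ballI)
  fix x :: real
  have ac: "abs_cont_on {x - 1..x + 1} u" using assms by (simp add: utilities_def)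
  show "isCont u x"
    unfolding continuous_at_eps_delta
  proof (intro allI impI)
    fix e :: real assume "0 < e"
    then obtain d where d: "0 < d"
      and D: "\<And>(n::nat) a b. (\<forall>i<n. a i \<le> b i \<and> {a i..b i} \<subseteq> {x - 1..x + 1}) \<Longrightarrow>
        disjoint_family_on (\<lambda>i. {a i<..<b i}) {..<n} \<Longrightarrow> (\<Sum>i<n. b i - a i) < d \<Longrightarrow>
        (\<Sum>i<n. \<bar>u (b i) - u (a i)\<bar>) < e"
      using ac unfolding abs_cont_on_def by meson
    have "dist (u y) (u x) < e" if "dist y x < min d 1" for y
    proof (cases "x \<le> y")
      case True
      then show ?thesis
        using D[of 1 "\<lambda>_. x" "\<lambda>_. y"] that by (auto simp: dist_real_def disjoint_family_on_def)
    next
      case False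
      then show ?thesis
        using D[of 1 "\<lambda>_. y" "\<lambda>_. x"] that
        by (auto simp: dist_real_def disjoint_family_on_def abs_minus_commute)
    qed
    then show "\<exists>d>0. \<forall>x'. dist x' x < d \<longrightarrow> dist (u x') (u x) < e"
      using d by (intro exI[of _ "min d 1"]) auto
  qed
qed

text \<open>The finite limsup gives a linear bound near +\<infinity>, and monotonicity gives a
  constant bound elsewhere. The bound is one-sided: near -\<infinity> a utility may fall faster than
  linearly.\<close>

lemma utility_linear_bound:
  assumes "u \<in> utilities F"
  obtains C D where "0 \<le> C" "0 \<le> D" "\<And>y. u y \<le> C + D * \<bar>y\<bar>"
proof -
  have mono: "strict_mono u" and L: "Limsup at_top (\<lambda>m. ereal (u m / m)) < \<infinity>"
    using assms by (auto simp: utilities_def)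
  obtain D :: real where D: "Limsup at_top (\<lambda>m. ereal (u m / m)) < ereal D"
    using L ereal_dense2 by blast
  from Limsup_lessD[OF D] obtain N where N: "\<And>m. N \<le> m \<Longrightarrow> u m / m < D"
    by (auto simp: eventually_at_top_linorder)
  define n where "n = max N 1"
  have "u y \<le> \<bar>u n\<bar> + \<bar>D\<bar> * \<bar>y\<bar>" for y
  proof (cases "n \<le> y")
    case True
    then have y: "0 < y" "N \<le> y" by (auto simp: n_def)
    then have "u y < D * y" using N[of y] by (simp add: field_simps)
    also have "\<dots> \<le> \<bar>D\<bar> * \<bar>y\<bar>" by (metis abs_ge_self abs_mult)
    finally show ?thesis by linarith
  next
    case False
    then have "u y \<le> u n" using mono by (simp add: strict_mono_less_eq)
    moreover have "0 \<le> \<bar>D\<bar> * \<bar>y\<bar>" by simp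
    ultimately show ?thesis by linarith
  qed
  then show thesis by (intro that[of "\<bar>u n\<bar>" "\<bar>D\<bar>"]) auto
qed

section \<open>Integrals with values in the extended reals\<close>

lemma ext_integral_eq_integral:
  assumes "integrable M g"
  shows "ext_integral M g = ereal (integral\<^sup>L M g)"
proof -
  have 1: "(\<integral>\<^sup>+ x. ennreal (g x) \<partial>M) = ennreal (integral\<^sup>L M (\<lambda>x. max 0 (g x)))"
    using assms by (subst nn_integral_eq_integral[symmetric]) (auto simp: ennreal_max_0)
  have 2: "(\<integral>\<^sup>+ x. ennreal (- g x) \<partial>M) = ennreal (integral\<^sup>L M (\<lambda>x. max 0 (- g x)))"
    using assms by (subst nn_integral_eq_integral[symmetric]) (auto simp: ennreal_max_0)
  have "integral\<^sup>L M (\<lambda>x. max 0 (g x)) - integral\<^sup>L M (\<lambda>x. max 0 (- g x)) = integral\<^sup>L M g"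
  proof -
    have "integral\<^sup>L M g = integral\<^sup>L M (\<lambda>x. max 0 (g x) - max 0 (- g x))"
      by (intro Bochner_Integration.integral_cong) (auto simp: max_def)
    also have "\<dots> = integral\<^sup>L M (\<lambda>x. max 0 (g x)) - integral\<^sup>L M (\<lambda>x. max 0 (- g x))"
      using assms by (intro Bochner_Integration.integral_diff) auto
    finally show ?thesis ..
  qed
  then show ?thesis
    unfolding ext_integral_def 1 2 by (simp add: enn2ereal_ennreal)
qed

lemma ext_integral_mono_AE:
  assumes "AE x in M. g x \<le> k x"
  shows "ext_integral M g \<le> ext_integral M k"
  unfolding ext_integral_def
  by (intro ereal_minus_mono; unfold less_eq_ennreal.rep_eq[symmetric]; 
      intro nn_integral_mono_AE; use assms in eventually_elim) (auto intro: ennreal_leI)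

text \<open>The dominating \<open>k\<close> makes the integral of the positive part finite. An
  infinite negative part would then give the value -\<infinity>, which the real lower bound
  \<open>c\<close> excludes.\<close>

lemma ext_integral_geD:
  assumes "g \<in> borel_measurable M" "integrable M k" "AE x in M. g x \<le> k x"
    and "ereal c \<le> ext_integral M g"
  shows "integrable M g" "c \<le> integral\<^sup>L M g"
proof -
  have "(\<integral>\<^sup>+ x. ennreal (g x) \<partial>M) \<le> (\<integral>\<^sup>+ x. ennreal (norm (k x)) \<partial>M)"
    by (intro nn_integral_mono_AE; use assms(3) in eventually_elim) (auto intro: ennreal_leI)
  also have "\<dots> < \<infinity>" using assms(2) by (simp add: integrable_iff_bounded)
  finally have P: "(\<integral>\<^sup>+ x. ennreal (g x) \<partial>M) < \<infinity>" .
  have N: "(\<integral>\<^sup>+ x. ennreal (- g x) \<partial>M) < \<infinity>"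
  proof (rule ccontr)
    assume "\<not> ?thesis"
    then have "(\<integral>\<^sup>+ x. ennreal (- g x) \<partial>M) = \<infinity>" by (metis infinity_ennreal_def less_top)
    moreover obtain p where "(\<integral>\<^sup>+ x. ennreal (g x) \<partial>M) = ennreal p" "0 \<le> p"
      using P by (cases "\<integral>\<^sup>+ x. ennreal (g x) \<partial>M") auto
    ultimately have "ext_integral M g = -\<infinity>"
      unfolding ext_integral_def by (simp add: enn2ereal_ennreal)
    with assms(4) show False by simp
  qed
  show "integrable M g"
    using P N assms(1) by (auto simp: real_integrable_def less_top)
  then show "c \<le> integral\<^sup>L M g"
    using assms(4) by (simp add: ext_integral_eq_integral)
qed

section \<open>Comparison of integrals through superlevel sets\<close>

text \<open>Tonelli on the region 0 \<le> t < p x. Where \<open>p\<close> is negative the region is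
  empty, in agreement with the truncation at 0 by \<open>ennreal\<close>.\<close>

lemma nn_integral_layer_cake:
  fixes p :: "'a \<Rightarrow> real"
  assumes "sigma_finite_measure M" and [measurable]: "p \<in> borel_measurable M"
  shows "(\<integral>\<^sup>+ x. ennreal (p x) \<partial>M) = (\<integral>\<^sup>+ t. indicator {0..} t * emeasure M {x \<in> space M. t < p x} \<partial>lborel)"
proof -
  interpret M: sigma_finite_measure M by fact
  interpret P: pair_sigma_finite M lborel ..
  have "(\<integral>\<^sup>+ x. ennreal (p x) \<partial>M) = (\<integral>\<^sup>+ x. (\<integral>\<^sup>+ t. indicator {0..} t * indicator {y\<in>space M. t < p y} x \<partial>lborel) \<partial>M)"
  proof (rule nn_integral_cong)
    fix x assume x: "x \<in> space M"
    have "(\<integral>\<^sup>+ t. indicator {0..} t * indicator {y\<in>space M. t < p y} x \<partial>lborel)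
        = (\<integral>\<^sup>+ t. indicator {0..<p x} t \<partial>lborel)"
      using x by (intro nn_integral_cong) (auto simp: indicator_def)
    also have "\<dots> = ennreal (p x)"
      by (cases "0 \<le> p x") (auto simp: ennreal_neg)
    finally show "ennreal (p x) = (\<integral>\<^sup>+ t. indicator {0..} t * indicator {y\<in>space M. t < p y} x \<partial>lborel)" ..
  qed
  also have "\<dots> = (\<integral>\<^sup>+ t. (\<integral>\<^sup>+ x. indicator {0..} t * indicator {y\<in>space M. t < p y} x \<partial>M) \<partial>lborel)"
    by (rule P.Fubini'[symmetric]) (simp add: split_beta' indicator_def, measurable)
  also have "\<dots> = (\<integral>\<^sup>+ t. indicator {0..} t * emeasure M {x \<in> space M. t < p x} \<partial>lborel)"
    by (intro nn_integral_cong) (simp add: nn_integral_cmult)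
  finally show ?thesis .
qed

lemma nn_integral_mono_level_sets:
  fixes p :: "'a \<Rightarrow> real"
  assumes "sigma_finite_measure M" "p \<in> borel_measurable M"
    and "sigma_finite_measure N" "p \<in> borel_measurable N"
    and "\<And>t. 0 \<le> t \<Longrightarrow> emeasure M {x \<in> space M. t < p x} \<le> emeasure N {x \<in> space N. t < p x}"
  shows "(\<integral>\<^sup>+ x. ennreal (p x) \<partial>M) \<le> (\<integral>\<^sup>+ x. ennreal (p x) \<partial>N)"
  unfolding nn_integral_layer_cake[OF assms(1,2)] nn_integral_layer_cake[OF assms(3,4)]
  by (intro nn_integral_mono) (auto simp: indicator_def assms(5))

section \<open>Supergradients and the monotone likelihood ratio order\<close>

text \<open>The slope \<open>k\<close> is the infimum of the slopes of the chords that end at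
  \<open>z\<close> from the left. By concavity no chord to the right of \<open>z\<close> is steeper,
  and since \<phi> increases all slopes are nonnegative.\<close>

lemma supergradient_exists:
  fixes \<phi> :: "real \<Rightarrow> real"
  assumes "strict_mono \<phi>" "concave_on UNIV \<phi>"
  obtains k where "0 \<le> k" "\<And>y. \<phi> y \<le> \<phi> z + k * (y - z)"
proof -
  define S where "S = (\<lambda>y. (\<phi> z - \<phi> y) / (z - y)) ` {..<z}"
  have lb: "(\<phi> c - \<phi> z) / (c - z) \<le> s" if "s \<in> S" "z < c" for s c
  proof -
    obtain a where a: "a < z" "s = (\<phi> z - \<phi> a) / (z - a)" using \<open>s \<in> S\<close> by (auto simp: S_def)
    \<comment> \<open>The weight that makes \<open>z\<close> the convex combination of
      \<open>a\<close> and \<open>c\<close>.\<close>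
    define t where "t = (z - a) / (c - a)"
    have t: "0 < t" "t < 1" "z = (1 - t) * a + t * c"
      using a \<open>z < c\<close> by (auto simp: t_def divide_simps) (simp add: algebra_simps)
    have "(1 - t) * \<phi> a + t * \<phi> c \<le> \<phi> ((1 - t) * a + t * c)"
      using concave_onD[OF assms(2), of t a c] t by simp
    then have *: "(1 - t) * \<phi> a + t * \<phi> c \<le> \<phi> z" using t(3) by simp
    have zc: "c - z = (1 - t) * (c - a)" "z - a = t * (c - a)" using t(3) by (auto simp: algebra_simps)
    have "t * (\<phi> c - \<phi> z) \<le> (1 - t) * (\<phi> z - \<phi> a)" using * by (simp add: algebra_simps)
    then have "(c - a) * (t * (\<phi> c - \<phi> z)) \<le> (c - a) * ((1 - t) * (\<phi> z - \<phi> a))"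
      using a \<open>z < c\<close> by (intro mult_left_mono) auto
    then have "t * (c - a) * (\<phi> c - \<phi> z) \<le> (1 - t) * (c - a) * (\<phi> z - \<phi> a)" by (simp only: mult_ac)
    then have "(\<phi> c - \<phi> z) * (z - a) \<le> (\<phi> z - \<phi> a) * (c - z)"
      unfolding zc by (simp only: mult_ac)
    then show ?thesis using a \<open>z < c\<close> by (simp add: pos_divide_le_eq pos_le_divide_eq)
  qed
  have ne: "S \<noteq> {}" by (auto simp: S_def)
  have nonneg: "0 \<le> s" if "s \<in> S" for s
    using that assms(1) by (auto simp: S_def strict_mono_less_eq divide_simps)
  then have bdd: "bdd_below S" by (auto simp: bdd_below_def)
  define k where "k = Inf S"
  have "\<phi> y \<le> \<phi> z + k * (y - z)" for y
  proof (cases y z rule: linorder_cases)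
    case less
    then have "(\<phi> z - \<phi> y) / (z - y) \<in> S" by (auto simp: S_def)
    then have "k \<le> (\<phi> z - \<phi> y) / (z - y)" unfolding k_def by (rule cInf_lower[OF _ bdd])
    then show ?thesis using less by (simp add: field_simps)
  next
    case greater
    then have "(\<phi> y - \<phi> z) / (y - z) \<le> k" unfolding k_def by (intro cInf_greatest[OF ne] lb)
    then show ?thesis using greater by (simp add: field_simps)
  qed auto
  moreover have "0 \<le> k" unfolding k_def by (intro cInf_greatest[OF ne] nonneg)
  ultimately show thesis by (rule that[rotated])
qed

text \<open>In a pair with one point in the up-set \<open>A\<close> and one outside, the outside
  point is the smaller one. Summing the likelihood ratio inequality over these pairs gives p(A) (1 -
  q(A)) \<le> (1 - p(A)) q(A), and the products cancel.\<close>

lemma MLR_upset_dominance: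
  fixes p q :: "real \<Rightarrow> real"
  assumes "finite X" "A \<subseteq> X"
    and up: "\<And>x x'. x \<in> A \<Longrightarrow> x' \<in> X \<Longrightarrow> x \<le> x' \<Longrightarrow> x' \<in> A"
    and sum: "sum p X = 1" "sum q X = 1"
    and mlr: "\<And>x x'. x \<in> X \<Longrightarrow> x' \<in> X \<Longrightarrow> x \<le> x' \<Longrightarrow> p x' * q x \<le> p x * q x'"
  shows "sum p A \<le> sum q A"
proof -
  have fin: "finite A" using assms by (auto intro: finite_subset)
  have "sum p A * sum q (X - A) = (\<Sum>x'\<in>A. \<Sum>x\<in>X - A. p x' * q x)"
    by (simp add: sum_product)
  also have "\<dots> \<le> (\<Sum>x'\<in>A. \<Sum>x\<in>X - A. p x * q x')"
    using up \<open>A \<subseteq> X\<close> by (intro sum_mono mlr) (auto, meson linear)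
  also have "\<dots> = sum p (X - A) * sum q A"
    by (subst sum.swap) (simp add: sum_product)
  finally have "sum p A * sum q (X - A) \<le> sum p (X - A) * sum q A" .
  moreover have "sum p (X - A) = 1 - sum p A" "sum q (X - A) = 1 - sum q A"
    using sum_diff[OF \<open>finite X\<close> \<open>A \<subseteq> X\<close>] sum by (metis)+
  ultimately show ?thesis by (simp add: algebra_simps)
qed

section \<open>Half-lines and first-order stochastic dominance\<close>

text \<open>Openness rules out closed half-lines: a point of the set always has smaller points of
  the set next to it, so the infimum is not attained.\<close>

lemma open_upset_real_cases:
  fixes U :: "real set"
  assumes "open U" and up: "\<And>x y. x \<in> U \<Longrightarrow> x \<le> y \<Longrightarrow> y \<in> U"
  obtains "U = {}" | "U = UNIV" | a where "U = {a<..}"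
proof -
  have "U = {Inf U<..}" if ne: "U \<noteq> {}" "U \<noteq> UNIV"
  proof -
    obtain z where z: "z \<notin> U" using ne by auto
    then have "z \<le> x" if "x \<in> U" for x using up[OF that, of z] by (meson linear)
    then have bdd: "bdd_below U" by (auto simp: bdd_below_def)
    have "Inf U < x" if x: "x \<in> U" for x
    proof -
      obtain e where "0 < e" "ball x e \<subseteq> U" using \<open>open U\<close> x by (auto simp: open_contains_ball)
      then have "x - e / 2 \<in> U" by (auto simp: dist_real_def)
      from cInf_lower[OF this bdd] \<open>0 < e\<close> show ?thesis by linarith
    qed
    moreover have "x \<in> U" if "Inf U < x" for x
      using that up by (auto simp: cInf_less_iff[OF ne(1) bdd])
    ultimately show ?thesis by auto
  qed
  then show thesis using that by metis
qed

lemma open_downset_real_cases: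
  fixes U :: "real set"
  assumes "open U" and down: "\<And>x y. x \<in> U \<Longrightarrow> y \<le> x \<Longrightarrow> y \<in> U"
  obtains "U = {}" | "U = UNIV" | a where "U = {..<a}"
proof -
  have "open (uminus ` U)" using assms(1) by (rule open_negations)
  moreover have "y \<in> uminus ` U" if "x \<in> uminus ` U" "x \<le> y" for x y
    using that down by (auto simp: image_iff intro!: bexI[of _ "- y"])
  ultimately consider "uminus ` U = {}" | "uminus ` U = UNIV" | a where "uminus ` U = {a<..}"
    by (rule open_upset_real_cases)
  then show thesis
  proof cases
    case 1 then show ?thesis using that by auto
  next
    case 2
    then have "uminus ` uminus ` U = (UNIV :: real set)" by simp
    then show ?thesis using that(2) by (simp only: image_image minus_minus image_ident)
  next
    case (3 a)
    then have "uminus ` uminus ` U = {..<- a}" by simp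
    then show ?thesis using that(3) by (simp only: image_image minus_minus image_ident)
  qed
qed

lemma measure_open_upset_le:
  assumes "real_distribution M" "real_distribution N" "open U"
    and "\<And>x y. x \<in> U \<Longrightarrow> x \<le> y \<Longrightarrow> y \<in> U"
    and le: "\<And>a. U = {a<..} \<Longrightarrow> cdf N a \<le> cdf M a"
  shows "measure M U \<le> measure N U"
proof (rule open_upset_real_cases[OF assms(3,4)])
  assume "U = {}" then show ?thesis by simp
next
  assume U: "U = UNIV"
  interpret M: real_distribution M by fact
  interpret N: real_distribution N by fact
  show ?thesis using M.prob_space N.prob_space U by simp
next
  fix a assume U: "U = {a<..}"
  interpret M: real_distribution M by fact
  interpret N: real_distribution N by fact
  have "measure M {a<..} = 1 - cdf M a" "measure N {a<..} = 1 - cdf N a"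
    using M.prob_compl[of "{..a}"] N.prob_compl[of "{..a}"]
    by (auto simp: cdf_def Compl_eq_Diff_UNIV[symmetric])
  then show ?thesis using le[OF U] U by simp
qed

text \<open>The measure of \<open>{..<a}\<close> is the left limit of the cdf at \<open>a\<close>,
  so the comparison is required strictly below \<open>a\<close> only. This fits a crossing point at
  which the order of the two cdfs is unknown.\<close>

lemma measure_open_downset_le:
  assumes "real_distribution M" "real_distribution N" "open U"
    and "\<And>x y. x \<in> U \<Longrightarrow> y \<le> x \<Longrightarrow> y \<in> U"
    and le: "\<And>a m. U = {..<a} \<Longrightarrow> m < a \<Longrightarrow> cdf M m \<le> cdf N m"
  shows "measure M U \<le> measure N U"
proof (rule open_downset_real_cases[OF assms(3,4)])
  assume "U = {}" then show ?thesis by simp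
next
  assume U: "U = UNIV"
  interpret M: real_distribution M by fact
  interpret N: real_distribution N by fact
  show ?thesis using M.prob_space N.prob_space U by simp
next
  fix a assume U: "U = {..<a}"
  interpret M: real_distribution M by fact
  interpret N: real_distribution N by fact
  have "measure M {..<a} \<le> measure N {..<a}"
    by (rule tendsto_le[OF _ N.cdf_at_left M.cdf_at_left])
      (auto simp: eventually_at_filter intro!: always_eventually le[OF U])
  then show ?thesis using U by simp
qed

text \<open>The superlevel sets of \<open>v\<close> are open up-sets and those of \<open>- v\<close>
  open down-sets, so the positive and negative parts are compared separately, whether or not their
  integrals are finite.\<close>

lemma ext_integral_mono_fosd:
  fixes v :: "real \<Rightarrow> real"
  assumes M: "real_distribution M" and N: "real_distribution N"
    and v: "continuous_on UNIV v" "mono v"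
    and le: "\<And>m. cdf N m \<le> cdf M m"
  shows "ext_integral M v \<le> ext_integral N v"
proof -
  interpret M: real_distribution M by fact
  interpret N: real_distribution N by fact
  have [measurable]: "v \<in> borel_measurable borel" using v(1) by (rule borel_measurable_continuous_onI)
  have o: "open {x. t < v x}" "open {x. t < - v x}" for t
    using v(1) by (auto intro!: open_Collect_less continuous_intros)
  have "(\<integral>\<^sup>+ x. ennreal (v x) \<partial>M) \<le> (\<integral>\<^sup>+ x. ennreal (v x) \<partial>N)"
  proof (rule nn_integral_mono_level_sets)
    fix t :: real
    show "emeasure M {x \<in> space M. t < v x} \<le> emeasure N {x \<in> space N. t < v x}"
      unfolding M.emeasure_eq_measure N.emeasure_eq_measure
      using measure_open_upset_le[OF M N o(1)] le monoD[OF v(2)]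
      by (auto intro!: ennreal_leI) (meson less_le_trans)
  qed (auto intro: M.sigma_finite_measure_axioms N.sigma_finite_measure_axioms)
  moreover have "(\<integral>\<^sup>+ x. ennreal (- v x) \<partial>N) \<le> (\<integral>\<^sup>+ x. ennreal (- v x) \<partial>M)"
  proof (rule nn_integral_mono_level_sets)
    fix t :: real
    show "emeasure N {x \<in> space N. t < - v x} \<le> emeasure M {x \<in> space M. t < - v x}"
      unfolding M.emeasure_eq_measure N.emeasure_eq_measure
      using measure_open_downset_le[OF N M o(2)] le monoD[OF v(2)]
      by (auto intro!: ennreal_leI) (meson le_imp_neg_le less_le_trans)
  qed (auto intro: M.sigma_finite_measure_axioms N.sigma_finite_measure_axioms)
  ultimately show ?thesis
    unfolding ext_integral_def by (intro ereal_minus_mono) (simp_all add: less_eq_ennreal.rep_eq)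
qed

text \<open>
  Subtracting from \<open>\<phi> \<circ> v\<close> a multiple of \<open>v\<close>, given by a supergradient of \<open>\<phi>\<close> at \<open>v m\<close>, leaves a
  function with a peak at \<open>m\<close>, whose mean is larger under the distribution that is more
  concentrated around \<open>m\<close>.
\<close>

lemma integral_concave_single_crossing:
  fixes u v \<phi> :: "real \<Rightarrow> real"
  assumes M: "real_distribution M" and N: "real_distribution N"
    and v: "continuous_on UNIV v" "mono v" and u: "continuous_on UNIV u"
    and \<phi>: "u = \<phi> \<circ> v" "strict_mono \<phi>" "concave_on UNIV \<phi>"
    and int: "integrable M v" "integrable N v" "integrable M u" "integrable N u"
    and lower: "\<And>x. x < m \<Longrightarrow> cdf M x \<le> cdf N x"
    and upper: "\<And>x. m < x \<Longrightarrow> cdf N x \<le> cdf M x"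
    and le: "integral\<^sup>L N v \<le> integral\<^sup>L M v"
  shows "integral\<^sup>L N u \<le> integral\<^sup>L M u"
proof -
  interpret M: real_distribution M by fact
  interpret N: real_distribution N by fact
  obtain k where k: "0 \<le> k" "\<And>y. \<phi> y \<le> \<phi> (v m) + k * (y - v m)"
    using supergradient_exists[OF \<phi>(2,3), of "v m"] by blast
  \<comment> \<open>Removing the supergradient line leaves a concave function with its maximum at
    \<open>v m\<close>, which therefore rises towards \<open>v m\<close> from both sides.\<close>
  define q where "q y = \<phi> y - k * y" for y
  have conc: "concave_on UNIV q"
    unfolding q_def[abs_def] using \<phi>(3)
    by (auto simp: concave_on_iff algebra_simps)
  have max: "q y \<le> q (v m)" for y using k(2)[of y] by (simp add: q_def algebra_simps)
  have between: "q a \<le> q ((1 - t) * a + t * v m)" if "0 \<le> t" "t \<le> 1" for a t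
  proof -
    have "q a = (1 - t) * q a + t * q a" by (simp add: algebra_simps)
    also have "\<dots> \<le> (1 - t) * q a + t * q (v m)" using that max by (simp add: mult_left_mono)
    also have "\<dots> \<le> q ((1 - t) * a + t * v m)"
      using concave_onD[OF conc that, of a "v m"] by simp
    finally show ?thesis .
  qed
  have q_between: "q a \<le> q b" if "a \<le> b \<and> b \<le> v m \<or> v m \<le> b \<and> b \<le> a" for a b
  proof (cases "a = v m")
    case True then show ?thesis using that by (cases "b = a") auto
  next
    case False
    define t where "t = (b - a) / (v m - a)"
    have "t * (v m - a) = b - a" using False by (simp add: t_def)
    then have "b = (1 - t) * a + t * v m" by (simp add: algebra_simps)
    moreover have "0 \<le> t" "t \<le> 1" using that False by (auto simp: t_def divide_simps)
    ultimately show ?thesis using between by metis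
  qed
  \<comment> \<open>The depth below the peak is nonnegative, so its integrals can be compared by
    superlevel sets.\<close>
  define p where "p x = q (v m) - q (v x)" for x
  have p_eq: "p x = q (v m) - (u x - k * v x)" for x by (simp add: p_def q_def \<phi>(1))
  have p_cont: "continuous_on UNIV p"
    unfolding p_eq[abs_def] using u v(1) by (intro continuous_intros) auto
  then have [measurable]: "p \<in> borel_measurable borel" by (rule borel_measurable_continuous_onI)
  have p0: "0 \<le> p x" for x using max by (simp add: p_def)
  have int_p: "integrable M p" "integrable N p" unfolding p_eq[abs_def] using int by auto
  have "(\<integral>\<^sup>+ x. ennreal (p x) \<partial>M) \<le> (\<integral>\<^sup>+ x. ennreal (p x) \<partial>N)"
  proof (rule nn_integral_mono_level_sets)
    fix t :: real assume t: "0 \<le> t"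
    define L where "L = {x. x < m} \<inter> {x. t < p x}"
    define U where "U = {x. m < x} \<inter> {x. t < p x}"
    have oL: "open L" and oU: "open U" unfolding L_def U_def
      using p_cont by (auto intro!: open_Int open_Collect_less continuous_intros)
    \<comment> \<open>The point \<open>m\<close> itself is in no superlevel set, because the depth
      there is 0 \<le> t.\<close>
    have un: "{x. t < p x} = L \<union> U"
    proof -
      have "p m = 0" by (simp add: p_def)
      then show ?thesis using t by (auto simp: L_def U_def) (metis linorder_less_linear not_le)
    qed
    have dj: "L \<inter> U = {}" by (auto simp: L_def U_def)
    have meas: "L \<in> sets borel" "U \<in> sets borel" using oL oU by auto
    have "measure M L \<le> measure N L"
    proof (rule measure_open_downset_le[OF M N oL])
      fix x y assume "x \<in> L" "y \<le> x"
      then show "y \<in> L"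
        using q_between[of "v y" "v x"] monoD[OF v(2), of y x] monoD[OF v(2), of x m]
        by (auto simp: L_def p_def)
    next
      fix a y assume a: "L = {..<a}" and "y < a"
      then have "y < m" by (auto simp: L_def)
      then show "cdf M y \<le> cdf N y" by (rule lower)
    qed
    moreover have "measure M U \<le> measure N U"
    proof (rule measure_open_upset_le[OF M N oU])
      fix x y assume "x \<in> U" "x \<le> y"
      then show "y \<in> U"
        using q_between[of "v y" "v x"] monoD[OF v(2), of x y] monoD[OF v(2), of m x]
        by (auto simp: U_def p_def)
    next
      fix a assume a: "U = {a<..}"
      then have *: "m < y" if "a < y" for y using that by (auto simp: U_def)
      \<comment> \<open>Possibly a = m, where \<open>upper\<close> says nothing; right continuity
        carries the inequality from the points above \<open>a\<close> to \<open>a\<close>.\<close>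
      have tN: "(cdf N \<longlongrightarrow> cdf N a) (at_right a)" and tM: "(cdf M \<longlongrightarrow> cdf M a) (at_right a)"
        using N.cdf_is_right_cont M.cdf_is_right_cont by (auto simp: continuous_within)
      show "cdf N a \<le> cdf M a"
        by (rule tendsto_le[OF _ tM tN])
          (auto simp: eventually_at_filter intro!: always_eventually upper *)
    qed
    ultimately show "emeasure M {x \<in> space M. t < p x} \<le> emeasure N {x \<in> space N. t < p x}"
      unfolding M.emeasure_eq_measure N.emeasure_eq_measure
      using M.finite_measure_Union[OF _ _ dj] N.finite_measure_Union[OF _ _ dj] meas
      by (intro ennreal_leI) (simp add: un)
  qed (auto intro: M.sigma_finite_measure_axioms N.sigma_finite_measure_axioms)
  then have "integral\<^sup>L M p \<le> integral\<^sup>L N p"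
    using int_p p0 by (simp add: nn_integral_eq_integral integral_nonneg_AE)
  moreover have "integral\<^sup>L M p = q (v m) - (integral\<^sup>L M u - k * integral\<^sup>L M v)"
    "integral\<^sup>L N p = q (v m) - (integral\<^sup>L N u - k * integral\<^sup>L N v)"
    unfolding p_eq[abs_def] using int M.prob_space N.prob_space by simp_all
  moreover have "k * integral\<^sup>L N v \<le> k * integral\<^sup>L M v" using le k(1) by (rule mult_left_mono)
  ultimately show ?thesis by linarith
qed

section \<open>Information environments\<close>

locale information_environment =
  fixes F :: "real measure" and f :: "real \<Rightarrow> real" and B :: "(real \<Rightarrow> real) set"
    and X :: "real set" and h :: "real \<Rightarrow> real pmf"
  assumes risk: "background_risk F f"
    and menu: "asset_menu F B"
    and signals: "MLR_experiment F X h"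
    and log_convex: "downward_log_convex f"
    and insurances: "insurance_menu F B"
begin

sublocale F: real_distribution F
  using risk unfolding background_risk_def by blast

lemma integrable_wealth: "integrable F (\<lambda>w. w)"
  and density_measurable [measurable]: "f \<in> borel_measurable borel"
  and density_nonneg: "0 \<le> f w"
  and F_eq: "F = density lborel (\<lambda>w. ennreal (f w))"
  using risk by (auto simp: background_risk_def)

lemma zero_in_menu: "(\<lambda>_. 0) \<in> B"
  using menu by (simp add: asset_menu_def)

lemma menu_integrable: "b \<in> B \<Longrightarrow> integrable F b"
  using menu by (auto simp: asset_menu_def asset_def)

lemma menu_measurable [measurable (raw)]: "b \<in> B \<Longrightarrow> b \<in> borel_measurable borel"
  using menu_integrable[of b] by (auto dest: borel_measurable_integrable)

lemma menu_antimono: "b \<in> B \<Longrightarrow> w \<le> w' \<Longrightarrow> b w' \<le> b w"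
  using insurances by (auto simp: insurance_menu_def insurance_def dest: antimonoD)

lemma menu_wealth_mono: "b \<in> B \<Longrightarrow> w \<le> w' \<Longrightarrow> w + b w \<le> w' + b w'"
  using insurances by (auto simp: insurance_menu_def insurance_def dest: monoD)

lemma finite_signals: "finite X"
  and set_pmf_signals: "set_pmf (h w) \<subseteq> X"
  and signal_measurable [measurable (raw)]: "x \<in> X \<Longrightarrow> (\<lambda>w. pmf (h w) x) \<in> borel_measurable borel"
  and MLR: "w \<le> w' \<Longrightarrow> x \<in> X \<Longrightarrow> x' \<in> X \<Longrightarrow> x \<le> x' \<Longrightarrow>
      pmf (h w) x' * pmf (h w') x \<le> pmf (h w) x * pmf (h w') x'"
  and signal_prob_pos: "x \<in> X \<Longrightarrow> 0 < signal_prob F h x"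
  using signals by (auto simp: MLR_experiment_def)

lemma sum_signals: "(\<Sum>x\<in>X. pmf (h w) x) = 1"
  using finite_signals set_pmf_signals by (rule sum_pmf_eq_1)

text \<open>By compactness finitely many of the L1 balls around 0 with integer radii cover
  \<open>B\<close>, which bounds the L1 norms by some \<open>n\<close>. An insurance is 1-Lipschitz,
  as \<open>b\<close> falls and \<open>w + b w\<close> rises. Integrating \<bar>b 0\<bar> \<le>
  \<bar>b w\<bar> + \<bar>w\<bar> bounds \<open>b 0\<close>, and the Lipschitz property spreads the
  bound to all \<open>w\<close>.\<close>

lemma menu_bounded_obtain:
  obtains K where "0 \<le> K" "\<And>b w. b \<in> B \<Longrightarrow> \<bar>b w\<bar> \<le> K + \<bar>w\<bar>"
proof -
  define U where "U n = {c. asset F c \<and> L1_dist F (\<lambda>_. 0) c < real n}" for n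
  have "L1_open F (U n)" for n
    unfolding L1_open_def
  proof (intro conjI ballI)
    show "U n \<subseteq> Collect (asset F)" by (auto simp: U_def)
    fix b assume b: "b \<in> U n"
    have "L1_dist F (\<lambda>_. 0) c \<le> L1_dist F (\<lambda>_. 0) b + L1_dist F b c" if "asset F c" for c
    proof -
      have i: "integrable F b" "integrable F c" using b that by (auto simp: U_def asset_def)
      have "L1_dist F (\<lambda>_. 0) c \<le> (\<integral>w. \<bar>0 - b w\<bar> + \<bar>b w - c w\<bar> \<partial>F)"
        unfolding L1_dist_def using i by (intro integral_mono) auto
      also have "\<dots> = L1_dist F (\<lambda>_. 0) b + L1_dist F b c"
        unfolding L1_dist_def using i by (intro Bochner_Integration.integral_add) auto
      finally show ?thesis .
    qed
    then show "\<exists>r>0. \<forall>c. asset F c \<and> L1_dist F b c < r \<longrightarrow> c \<in> U n"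
      using b by (intro exI[of _ "real n - L1_dist F (\<lambda>_. 0) b"]) (force simp: U_def)
  qed
  then have "\<forall>U\<in>range U. openin (L1_topology F) U" by (auto simp: openin_L1_topology)
  moreover have "B \<subseteq> \<Union>(range U)"
    using menu reals_Archimedean2 by (fastforce simp: U_def asset_menu_def)
  moreover have "compactin (L1_topology F) B" using menu by (simp add: asset_menu_def)
  ultimately obtain \<F> where \<F>: "finite \<F>" "\<F> \<subseteq> range U" "B \<subseteq> \<Union>\<F>"
    unfolding compactin_def by (metis (no_types, lifting))
  obtain I where I: "finite I" "\<F> = U ` I" using finite_subset_image[OF \<F>(1,2)] by auto
  define n where "n = Max (insert 0 I)"
  have L1: "L1_dist F (\<lambda>_. 0) b \<le> real n" if b: "b \<in> B" for b
  proof -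
    obtain i where i: "i \<in> I" "b \<in> U i" using \<F>(3) I b by auto
    then have "i \<le> n" using I by (auto simp: n_def)
    then show ?thesis using i by (auto simp: U_def)
  qed
  define E where "E = (\<integral>w. \<bar>w\<bar> \<partial>F)"
  have "0 \<le> E" unfolding E_def by (intro integral_nonneg_AE) auto
  have lip: "\<bar>b w - b w'\<bar> \<le> \<bar>w - w'\<bar>" if "b \<in> B" for b w w'
    using menu_antimono[OF that, of w w'] menu_antimono[OF that, of w' w]
      menu_wealth_mono[OF that, of w w'] menu_wealth_mono[OF that, of w' w]
    by (cases "w \<le> w'") auto
  have "\<bar>b w\<bar> \<le> (real n + E) + \<bar>w\<bar>" if b: "b \<in> B" for b w
  proof -
    have i: "integrable F b" using b by (rule menu_integrable)
    have "\<bar>b 0\<bar> = (\<integral>w. \<bar>b 0\<bar> \<partial>F)" using F.prob_space by simp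
    also have "\<dots> \<le> (\<integral>w. \<bar>0 - b w\<bar> + \<bar>w\<bar> \<partial>F)"
    proof (intro integral_mono)
      show "\<bar>b 0\<bar> \<le> \<bar>0 - b w\<bar> + \<bar>w\<bar>" for w using lip[OF b, of 0 w] by auto
    qed (use i integrable_wealth in auto)
    also have "\<dots> = L1_dist F (\<lambda>_. 0) b + E"
      unfolding L1_dist_def E_def using i integrable_wealth
      by (intro Bochner_Integration.integral_add) auto
    finally show ?thesis using L1[OF b] lip[OF b, of w 0] by auto
  qed
  then show thesis using \<open>0 \<le> E\<close> by (intro that[of "real n + E"]) auto
qed

definition menu_bound :: real where
  "menu_bound = (SOME K. 0 \<le> K \<and> (\<forall>b\<in>B. \<forall>w. \<bar>b w\<bar> \<le> K + \<bar>w\<bar>))"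

lemma menu_bound: "0 \<le> menu_bound" "b \<in> B \<Longrightarrow> \<bar>b w\<bar> \<le> menu_bound + \<bar>w\<bar>"
proof -
  have "\<exists>K. 0 \<le> K \<and> (\<forall>b\<in>B. \<forall>w. \<bar>b w\<bar> \<le> K + \<bar>w\<bar>)"
    using menu_bounded_obtain by metis
  from someI_ex[OF this] show "0 \<le> menu_bound" "b \<in> B \<Longrightarrow> \<bar>b w\<bar> \<le> menu_bound + \<bar>w\<bar>"
    unfolding menu_bound_def by auto
qed

subsection \<open>The joint law of signal and background wealth\<close>

text \<open>Given background wealth \<open>w\<close>, the signal has law \<open>h w\<close>. On this
  space terminal wealth is a single random variable, so sums of posterior integrals become one
  integral.\<close>

definition joint :: "(real \<times> real) measure" where
  "joint = density (count_space X \<Otimes>\<^sub>M F) (\<lambda>(x, w). ennreal (pmf (h w) x))"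

definition terminal :: "(real \<Rightarrow> real \<Rightarrow> real) \<Rightarrow> real \<Rightarrow> real \<times> real \<Rightarrow> real" where
  "terminal \<beta> \<mu> = (\<lambda>(x, w). w + \<beta> x w - \<mu>)"

lemma sets_joint [measurable_cong]: "sets joint = sets (count_space X \<Otimes>\<^sub>M F)"
  and space_joint: "space joint = X \<times> UNIV"
  by (auto simp: joint_def space_pair_measure)

lemma signal_pair_measurable [measurable]:
  "(\<lambda>(x, w). pmf (h w) x) \<in> borel_measurable (count_space X \<Otimes>\<^sub>M F)"
  by (intro measurable_pair_measure_countable1) (auto simp: countable_finite finite_signals)

lemma terminal_measurable [measurable (raw)]:
  assumes "\<And>x. x \<in> X \<Longrightarrow> \<beta> x \<in> B"
  shows "terminal \<beta> \<mu> \<in> borel_measurable joint"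
proof -
  have "terminal \<beta> \<mu> \<in> borel_measurable (count_space X \<Otimes>\<^sub>M F)"
    using menu_measurable assms unfolding terminal_def
    by (intro measurable_pair_measure_countable1) (auto simp: countable_finite finite_signals)
  then show ?thesis by (simp cong: measurable_cong_sets add: sets_joint)
qed

lemma pair_sigma_finite_signals: "pair_sigma_finite (count_space X) F"
  unfolding pair_sigma_finite_def
  using finite_signals F.sigma_finite_measure_axioms
  by (auto intro: sigma_finite_measure_count_space_finite)

lemma nn_integral_joint:
  assumes g: "g \<in> borel_measurable joint"
  shows "(\<integral>\<^sup>+ z. g z \<partial>joint) = (\<Sum>x\<in>X. \<integral>\<^sup>+ w. ennreal (pmf (h w) x) * g (x, w) \<partial>F)"
proof -
  interpret P: pair_sigma_finite "count_space X" F by (rule pair_sigma_finite_signals)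
  have [measurable]: "g \<in> borel_measurable (count_space X \<Otimes>\<^sub>M F)"
    using g by (simp cong: measurable_cong_sets add: sets_joint)
  have "(\<integral>\<^sup>+ z. g z \<partial>joint) = (\<integral>\<^sup>+ z. (case z of (x, w) \<Rightarrow> ennreal (pmf (h w) x)) * g z \<partial>(count_space X \<Otimes>\<^sub>M F))"
    unfolding joint_def by (intro nn_integral_density) (auto simp: split_beta')
  also have "\<dots> = (\<integral>\<^sup>+ x. \<integral>\<^sup>+ w. ennreal (pmf (h w) x) * g (x, w) \<partial>F \<partial>count_space X)"
    by (subst F.nn_integral_fst[symmetric]) (auto simp: split_beta')
  also have "\<dots> = (\<Sum>x\<in>X. \<integral>\<^sup>+ w. ennreal (pmf (h w) x) * g (x, w) \<partial>F)"
    by (rule nn_integral_count_space_finite[OF finite_signals])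
  finally show ?thesis .
qed

lemma integral_joint:
  assumes g: "integrable joint g"
  shows "(\<integral>z. g z \<partial>joint) = (\<Sum>x\<in>X. \<integral>w. pmf (h w) x * g (x, w) \<partial>F)"
    and "x \<in> X \<Longrightarrow> integrable F (\<lambda>w. pmf (h w) x * g (x, w))"
proof -
  interpret P: pair_sigma_finite "count_space X" F by (rule pair_sigma_finite_signals)
  have [measurable]: "g \<in> borel_measurable (count_space X \<Otimes>\<^sub>M F)"
    using g by (auto dest!: borel_measurable_integrable simp: sets_joint cong: measurable_cong_sets)
  have j: "joint = density (count_space X \<Otimes>\<^sub>M F) (\<lambda>z. ennreal (pmf (h (snd z)) (fst z)))"
    by (simp add: joint_def split_beta')
  have [measurable]: "(\<lambda>z. pmf (h (snd z)) (fst z)) \<in> borel_measurable (count_space X \<Otimes>\<^sub>M F)"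
    using signal_pair_measurable by (simp add: split_beta')
  have i: "integrable (count_space X \<Otimes>\<^sub>M F) (\<lambda>z. pmf (h (snd z)) (fst z) * g z)"
    using g unfolding j by (subst (asm) integrable_density) auto
  have "(\<integral>z. g z \<partial>joint) = (\<integral>z. pmf (h (snd z)) (fst z) * g z \<partial>(count_space X \<Otimes>\<^sub>M F))"
    unfolding j by (subst integral_density) auto
  also have "\<dots> = (\<integral>x. \<integral>w. pmf (h w) x * g (x, w) \<partial>F \<partial>count_space X)"
    using P.integral_fst'[OF i] by simp
  also have "\<dots> = (\<Sum>x\<in>X. \<integral>w. pmf (h w) x * g (x, w) \<partial>F)"
    by (rule lebesgue_integral_count_space_finite[OF finite_signals])
  finally show "(\<integral>z. g z \<partial>joint) = (\<Sum>x\<in>X. \<integral>w. pmf (h w) x * g (x, w) \<partial>F)" .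
  show "integrable F (\<lambda>w. pmf (h w) x * g (x, w))" if "x \<in> X"
    using P.AE_integrable_fst'[OF i] that by (simp add: AE_count_space)
qed

lemma distr_joint_snd: "distr joint borel snd = F"
proof (rule measure_eqI)
  fix A :: "real set" assume "A \<in> sets (distr joint borel snd)"
  then have A [measurable]: "A \<in> sets borel" by simp
  have "emeasure (distr joint borel snd) A = (\<integral>\<^sup>+ z. indicator A (snd z) \<partial>joint)"
    by (subst nn_integral_indicator[symmetric], simp, subst nn_integral_distr) auto
  also have "\<dots> = (\<Sum>x\<in>X. \<integral>\<^sup>+ w. ennreal (pmf (h w) x) * indicator A w \<partial>F)"
    by (subst nn_integral_joint) auto
  also have "\<dots> = (\<integral>\<^sup>+ w. (\<Sum>x\<in>X. ennreal (pmf (h w) x)) * indicator A w \<partial>F)"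
    by (subst nn_integral_sum[symmetric]) (auto simp: sum_distrib_right simp del: sum_ennreal)
  also have "\<dots> = emeasure F A"
    by (subst sum_ennreal) (simp_all add: sum_signals)
  finally show "emeasure (distr joint borel snd) A = emeasure F A" .
qed simp

sublocale J: prob_space joint
proof
  have "emeasure F UNIV = 1" using F.emeasure_space_1 by simp
  then have "emeasure (distr joint borel snd) UNIV = 1" by (simp only: distr_joint_snd)
  then show "emeasure joint (space joint) = 1" by (simp add: emeasure_distr)
qed

lemma integrable_joint_snd: "integrable F g \<Longrightarrow> integrable joint (\<lambda>z. g (snd z))"
  and integral_joint_snd: "g \<in> borel_measurable borel \<Longrightarrow> (\<integral>z. g (snd z) \<partial>joint) = (\<integral>w. g w \<partial>F)"
  for g :: "real \<Rightarrow> real"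
proof -
  have s: "snd \<in> measurable joint borel" by measurable
  show "integrable joint (\<lambda>z. g (snd z))" if "integrable F g"
    using that integrable_distr[OF s, of g] by (simp add: distr_joint_snd)
  show "(\<integral>z. g (snd z) \<partial>joint) = (\<integral>w. g w \<partial>F)" if "g \<in> borel_measurable borel"
    using integral_distr[OF s that] by (simp add: distr_joint_snd)
qed

lemma AE_joint_snd: "AE w in F. P w \<Longrightarrow> AE z in joint. P (snd z)"
  using AE_distrD[of snd joint borel P, unfolded distr_joint_snd] by simp

lemma ext_integral_joint_snd:
  assumes [measurable]: "g \<in> borel_measurable borel"
  shows "ext_integral joint (\<lambda>z. g (snd z)) = ext_integral F g"
proof -
  have "ext_integral (distr joint borel snd) g = ext_integral joint (\<lambda>z. g (snd z))"
    unfolding ext_integral_def by (simp add: nn_integral_distr)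
  then show ?thesis by (simp add: distr_joint_snd)
qed

lemma posterior_eq:
  assumes "x \<in> X"
  shows "posterior F f h x = density F (\<lambda>w. ennreal (pmf (h w) x / signal_prob F h x))"
proof -
  have [measurable]: "(\<lambda>w. pmf (h w) x) \<in> borel_measurable borel" using assms by measurable
  have "density F (\<lambda>w. ennreal (pmf (h w) x / signal_prob F h x)) =
    density lborel (\<lambda>w. ennreal (f w) * ennreal (pmf (h w) x / signal_prob F h x))"
    unfolding F_eq using F_eq by (subst density_density_eq) auto
  also have "\<dots> = posterior F f h x"
    unfolding posterior_def using signal_prob_pos[OF assms] density_nonneg
    by (intro density_cong) (auto simp: ennreal_mult[symmetric] mult.commute)
  finally show ?thesis ..
qed

text \<open>The weight \<open>signal_prob\<close> of a signal cancels the normalization of its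
  posterior, which leaves the joint probability of the signal and of terminal wealth at most
  \<open>m\<close>.\<close>

lemma wealth_cdf_eq:
  assumes \<beta>: "\<And>x. x \<in> X \<Longrightarrow> \<beta> x \<in> B"
  shows "wealth_cdf F f X h \<mu> \<beta> = cdf (distr joint borel (terminal \<beta> \<mu>))"
proof
  fix m
  have T [measurable]: "terminal \<beta> \<mu> \<in> borel_measurable joint" using \<beta> by (rule terminal_measurable)
  have "cdf (distr joint borel (terminal \<beta> \<mu>)) m = measure joint (terminal \<beta> \<mu> -` {..m} \<inter> space joint)"
    unfolding cdf_def by (subst measure_distr) auto
  also have "\<dots> = (\<integral>z. indicator (terminal \<beta> \<mu> -` {..m} \<inter> space joint) z \<partial>joint)"
    by simp
  also have "\<dots> = (\<Sum>x\<in>X. \<integral>w. pmf (h w) x * indicator (terminal \<beta> \<mu> -` {..m} \<inter> space joint) (x, w) \<partial>F)"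
    by (rule integral_joint) (auto intro!: integrable_real_indicator simp: J.emeasure_eq_measure)
  also have "\<dots> = (\<Sum>x\<in>X. signal_prob F h x * (\<integral>w. indicator {w. w + \<beta> x w - \<mu> \<le> m} w \<partial>posterior F f h x))"
  proof (intro sum.cong refl)
    fix x assume x: "x \<in> X"
    have [measurable]: "(\<lambda>w. pmf (h w) x) \<in> borel_measurable borel" "\<beta> x \<in> borel_measurable borel"
      using x \<beta> by measurable
    have "(\<integral>w. indicator {w. w + \<beta> x w - \<mu> \<le> m} w \<partial>posterior F f h x)
      = (\<integral>w. (pmf (h w) x / signal_prob F h x) * indicator {w. w + \<beta> x w - \<mu> \<le> m} w \<partial>F)"
      unfolding posterior_eq[OF x] using signal_prob_pos[OF x]
      by (subst integral_density) auto
    also have "\<dots> = (\<integral>w. pmf (h w) x * indicator (terminal \<beta> \<mu> -` {..m} \<inter> space joint) (x, w) \<partial>F) / signal_prob F h x"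
      by (subst integral_divide_zero[symmetric], intro Bochner_Integration.integral_cong)
        (auto simp: terminal_def space_joint x indicator_def)
    finally show "(\<integral>w. pmf (h w) x * indicator (terminal \<beta> \<mu> -` {..m} \<inter> space joint) (x, w) \<partial>F) =
      signal_prob F h x * (\<integral>w. indicator {w. w + \<beta> x w - \<mu> \<le> m} w \<partial>posterior F f h x)"
      using signal_prob_pos[OF x] by simp
  qed
  finally show "wealth_cdf F f X h \<mu> \<beta> m = cdf (distr joint borel (terminal \<beta> \<mu>)) m"
    by (simp add: wealth_cdf_def)
qed

lemma real_distribution_terminal:
  assumes "\<And>x. x \<in> X \<Longrightarrow> \<beta> x \<in> B"
  shows "real_distribution (distr joint borel (terminal \<beta> \<mu>))"
proof -
  have T: "terminal \<beta> \<mu> \<in> borel_measurable joint" using assms by (rule terminal_measurable)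
  interpret prob_space "distr joint borel (terminal \<beta> \<mu>)" using T by (rule J.prob_space_distr)
  show ?thesis by unfold_locales auto
qed

text \<open>A distribution on the line is determined by its cdf, so the Stieltjes measure is the law
  of terminal wealth and expected utility can be computed under \<open>joint\<close>.\<close>

lemma interval_measure_wealth_cdf:
  assumes "\<And>x. x \<in> X \<Longrightarrow> \<beta> x \<in> B"
  shows "interval_measure (wealth_cdf F f X h \<mu> \<beta>) = distr joint borel (terminal \<beta> \<mu>)"
proof -
  let ?N = "distr joint borel (terminal \<beta> \<mu>)"
  interpret N: real_distribution ?N using assms by (rule real_distribution_terminal)
  have "real_distribution (interval_measure (cdf ?N))" "cdf (interval_measure (cdf ?N)) = cdf ?N"
    by (rule real_distribution_interval_measure cdf_interval_measure;
      auto intro: N.cdf_nondecreasing N.cdf_is_right_cont N.cdf_lim_at_bot N.cdf_lim_at_top_prob)+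
  then show ?thesis
    using wealth_cdf_eq[of \<beta>, OF assms] cdf_unique[OF _ N.real_distribution_axioms] by simp
qed

lemma max_expected_utility_eq:
  assumes "u \<in> borel_measurable borel"
  shows "max_expected_utility F f B X h u \<mu> =
    (SUP \<beta> \<in> X \<rightarrow>\<^sub>E B. ext_integral joint (\<lambda>z. u (terminal \<beta> \<mu> z)))"
  unfolding max_expected_utility_def
proof (intro SUP_cong refl)
  fix \<beta> assume "\<beta> \<in> X \<rightarrow>\<^sub>E B"
  then have \<beta>: "x \<in> X \<Longrightarrow> \<beta> x \<in> B" for x by auto
  have "terminal \<beta> \<mu> \<in> borel_measurable joint" using \<beta> by (rule terminal_measurable)
  then show "ext_integral (interval_measure (wealth_cdf F f X h \<mu> \<beta>)) u =
      ext_integral joint (\<lambda>z. u (terminal \<beta> \<mu> z))"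
    using assms \<beta> unfolding ext_integral_def
    by (simp add: interval_measure_wealth_cdf nn_integral_distr)
qed

subsection \<open>Existence of the willingness to pay\<close>

lemma utility_measurable: "u \<in> utilities F \<Longrightarrow> u \<in> borel_measurable borel"
  by (intro borel_measurable_continuous_onI utility_continuous)

lemma expected_utility_measurable:
  assumes "u \<in> utilities F" "\<And>x. x \<in> X \<Longrightarrow> \<beta> x \<in> B"
  shows "(\<lambda>z. u (terminal \<beta> \<mu> z)) \<in> borel_measurable joint"
  using utility_measurable[OF assms(1)] terminal_measurable[of \<beta>, OF assms(2)]
  by (rule measurable_compose[rotated])

lemma abs_terminal_le:
  assumes "\<And>x. x \<in> X \<Longrightarrow> \<beta> x \<in> B" "z \<in> space joint"
  shows "\<bar>terminal \<beta> \<mu> z\<bar> \<le> menu_bound + \<bar>\<mu>\<bar> + 2 * \<bar>snd z\<bar>"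
  using assms menu_bound(2)[of "\<beta> (fst z)" "snd z"]
  by (auto simp: terminal_def space_joint split_beta')

text \<open>One integrable bound serves all strategies, since terminal wealth is at most linear in
  background wealth uniformly over \<open>B\<close> and utility grows at most linearly.\<close>

lemma utility_terminal_dominated:
  assumes "u \<in> utilities F"
  obtains k where "integrable joint k"
    "\<And>\<beta>. (\<And>x. x \<in> X \<Longrightarrow> \<beta> x \<in> B) \<Longrightarrow> AE z in joint. u (terminal \<beta> \<mu> z) \<le> k z"
proof -
  obtain C D where CD: "0 \<le> C" "0 \<le> D" "\<And>y. u y \<le> C + D * \<bar>y\<bar>"
    using utility_linear_bound[OF assms] by blast
  define k where "k z = C + D * (menu_bound + \<bar>\<mu>\<bar> + 2 * \<bar>snd z\<bar>)" for z :: "real \<times> real"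
  have "integrable joint k"
    unfolding k_def[abs_def]
    by (rule integrable_joint_snd[of "\<lambda>w. C + D * (menu_bound + \<bar>\<mu>\<bar> + 2 * \<bar>w\<bar>)"])
      (auto intro!: integrable_wealth Bochner_Integration.integrable_add integrable_mult_right)
  moreover have "u (terminal \<beta> \<mu> z) \<le> k z" if "\<And>x. x \<in> X \<Longrightarrow> \<beta> x \<in> B" "z \<in> space joint" for \<beta> z
  proof -
    have "u (terminal \<beta> \<mu> z) \<le> C + D * \<bar>terminal \<beta> \<mu> z\<bar>" by (rule CD(3))
    also have "\<dots> \<le> k z"
      using abs_terminal_le[of \<beta> z \<mu>] that CD(2) by (auto simp: k_def intro: mult_left_mono)
    finally show ?thesis .
  qed
  ultimately show thesis by (intro that) (auto intro: AE_I2)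
qed

lemma expected_utility_geD:
  assumes "u \<in> utilities F" "\<And>x. x \<in> X \<Longrightarrow> \<beta> x \<in> B"
    and "ereal c \<le> ext_integral joint (\<lambda>z. u (terminal \<beta> \<mu> z))"
  shows "integrable joint (\<lambda>z. u (terminal \<beta> \<mu> z))" "c \<le> (\<integral>z. u (terminal \<beta> \<mu> z) \<partial>joint)"
proof -
  obtain k where k: "integrable joint k" "AE z in joint. u (terminal \<beta> \<mu> z) \<le> k z"
    using utility_terminal_dominated[OF assms(1)] assms(2) by metis
  show "integrable joint (\<lambda>z. u (terminal \<beta> \<mu> z))" "c \<le> (\<integral>z. u (terminal \<beta> \<mu> z) \<partial>joint)"
    using ext_integral_geD[OF expected_utility_measurable[of u \<beta>, OF assms(1,2)] k assms(3)] by auto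
qed

lemma background_concentrated:
  obtains n :: nat where "0 < measure F {- real n..real n}"
proof -
  have "(\<lambda>n. measure F {- real n..real n}) \<longlonglongrightarrow> measure F (\<Union>n. {- real n..real n})"
    by (rule F.finite_Lim_measure_incseq) (auto simp: incseq_def)
  also have "(\<Union>n. {- real n..real n}) = UNIV"
  proof -
    have "\<exists>n. x \<in> {- real n..real n}" for x :: real
      using real_arch_simple[of "\<bar>x\<bar>"] by (auto simp: abs_le_iff minus_le_iff)
    then show ?thesis by blast
  qed
  also have "measure F UNIV = 1" using F.prob_space by simp
  finally have "eventually (\<lambda>n. 0 < measure F {- real n..real n}) sequentially"
    by (rule order_tendstoD) simp
  then show thesis using that by (auto simp: eventually_sequentially)
qed

text \<open>
  By domination, all terminal wealths lie in a common compact interval whenever background wealth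
  lies in \<open>{-n..n}\<close>; there a change of price changes utility by a uniform amount.
\<close>

lemma expected_utility_price_gap:
  assumes u: "u \<in> utilities F" and "\<mu> < \<mu>'"
  obtains \<eta> where "0 < \<eta>"
    "\<And>\<beta>. (\<And>x. x \<in> X \<Longrightarrow> \<beta> x \<in> B) \<Longrightarrow> integrable joint (\<lambda>z. u (terminal \<beta> \<mu>' z)) \<Longrightarrow>
      ereal ((\<integral>z. u (terminal \<beta> \<mu>' z) \<partial>joint) + \<eta>) \<le> ext_integral joint (\<lambda>z. u (terminal \<beta> \<mu> z))"
proof -
  have cont: "continuous_on UNIV u" and sm: "strict_mono u"
    using u utility_continuous by (auto simp: utilities_def)
  obtain n :: nat where n: "0 < measure F {- real n..real n}" by (rule background_concentrated)
  \<comment> \<open>The bound of \<open>abs_terminal_le\<close> when \<bar>snd z\<bar> \<le>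
    n.\<close>
  define R where "R = menu_bound + \<bar>\<mu>\<bar> + 2 * real n"
  have R: "0 \<le> R" using menu_bound(1) by (simp add: R_def)
  \<comment> \<open>The utility lost by paying the higher price when wealth at the lower price is
    \<open>y\<close>. Its minimum over the compact interval is positive and, times the mass of the
    window, serves as \<eta>.\<close>
  define g where "g y = u y - u (y - (\<mu>' - \<mu>))" for y
  have "continuous_on {- R..R} g"
    unfolding g_def[abs_def]
    by (intro continuous_intros continuous_on_compose2[OF cont]) (auto intro: continuous_on_subset[OF cont])
  then obtain y0 where y0: "\<And>y. y \<in> {- R..R} \<Longrightarrow> g y0 \<le> g y"
    using continuous_attains_inf[of "{- R..R}" g] R by (metis atLeastAtMost_iff compact_Icc empty_iff neg_le_0_iff_le order_trans)
  have g: "0 < g y" for y using sm \<open>\<mu> < \<mu>'\<close> by (simp add: g_def strict_mono_less)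
  have "ereal ((\<integral>z. u (terminal \<beta> \<mu>' z) \<partial>joint) + g y0 * measure F {- real n..real n})
      \<le> ext_integral joint (\<lambda>z. u (terminal \<beta> \<mu> z))"
    if \<beta>: "\<And>x. x \<in> X \<Longrightarrow> \<beta> x \<in> B" and i: "integrable joint (\<lambda>z. u (terminal \<beta> \<mu>' z))" for \<beta>
  proof -
    let ?I = "\<lambda>z. indicator {- real n..real n} (snd z) :: real"
    have "integrable F (indicator {- real n..real n} :: real \<Rightarrow> real)"
      by (auto intro!: integrable_real_indicator simp: F.emeasure_eq_measure)
    then have iI: "integrable joint ?I" by (rule integrable_joint_snd)
    have "(\<integral>z. ?I z \<partial>joint) = measure F {- real n..real n}"
      by (subst integral_joint_snd) auto
    then have "(\<integral>z. u (terminal \<beta> \<mu>' z) \<partial>joint) + g y0 * measure F {- real n..real n}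
        = (\<integral>z. u (terminal \<beta> \<mu>' z) + g y0 * ?I z \<partial>joint)"
      using i iI by simp
    also have "ereal \<dots> = ext_integral joint (\<lambda>z. u (terminal \<beta> \<mu>' z) + g y0 * ?I z)"
      using i iI by (intro ext_integral_eq_integral[symmetric]) auto
    also have "\<dots> \<le> ext_integral joint (\<lambda>z. u (terminal \<beta> \<mu> z))"
    proof (intro ext_integral_mono_AE AE_I2)
      fix z assume z: "z \<in> space joint"
      have t: "terminal \<beta> \<mu>' z = terminal \<beta> \<mu> z - (\<mu>' - \<mu>)" by (simp add: terminal_def split_beta')
      have "g y0 * ?I z \<le> g (terminal \<beta> \<mu> z)"
      proof (cases "snd z \<in> {- real n..real n}")
        case True
        then have "\<bar>terminal \<beta> \<mu> z\<bar> \<le> R" using abs_terminal_le[of \<beta> z \<mu>, OF \<beta> z] by (auto simp: R_def)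
        then show ?thesis using True y0[of "terminal \<beta> \<mu> z"] by (auto simp: abs_le_iff)
      qed (use g in \<open>auto intro: less_imp_le\<close>)
      then show "u (terminal \<beta> \<mu>' z) + g y0 * ?I z \<le> u (terminal \<beta> \<mu> z)"
        by (simp add: g_def t)
    qed
    finally show ?thesis .
  qed
  then show thesis using g n by (intro that[of "g y0 * measure F {- real n..real n}"]) auto
qed

abbreviation V :: "(real \<Rightarrow> real) \<Rightarrow> real \<Rightarrow> ereal" where
  "V u \<mu> \<equiv> max_expected_utility F f B X h u \<mu>"

lemma le_V:
  assumes "u \<in> utilities F" "\<And>x. x \<in> X \<Longrightarrow> \<beta> x \<in> B"
  shows "ext_integral joint (\<lambda>z. u (terminal \<beta> \<mu> z)) \<le> V u \<mu>"
proof -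
  \<comment> \<open>The supremum ranges over extensional functions on \<open>X\<close>; restricting
    \<beta> changes nothing on the space of \<open>joint\<close>.\<close>
  have "ext_integral joint (\<lambda>z. u (terminal \<beta> \<mu> z)) = ext_integral joint (\<lambda>z. u (terminal (restrict \<beta> X) \<mu> z))"
    unfolding ext_integral_def
    by (intro arg_cong2[where f="(-)"] arg_cong[where f=enn2ereal] nn_integral_cong)
      (auto simp: terminal_def space_joint)
  also have "\<dots> \<le> V u \<mu>"
    unfolding max_expected_utility_eq[OF utility_measurable[OF assms(1)]]
    by (rule SUP_upper) (use assms in auto)
  finally show ?thesis .
qed

lemma less_V_obtain:
  assumes "u \<in> utilities F" "c < V u \<mu>"
  obtains \<beta> where "\<And>x. x \<in> X \<Longrightarrow> \<beta> x \<in> B" "c < ext_integral joint (\<lambda>z. u (terminal \<beta> \<mu> z))"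
proof -
  obtain \<beta> where "\<beta> \<in> X \<rightarrow>\<^sub>E B" "c < ext_integral joint (\<lambda>z. u (terminal \<beta> \<mu> z))"
    using assms(2) unfolding max_expected_utility_eq[OF utility_measurable[OF assms(1)]] less_SUP_iff
    by auto
  then show thesis by (intro that) auto
qed

lemma ext_integral_utility: "u \<in> utilities F \<Longrightarrow> ext_integral F u = ereal (\<integral>w. u w \<partial>F)"
  by (intro ext_integral_eq_integral) (simp add: utilities_def)

lemma V_at_0: "u \<in> utilities F \<Longrightarrow> ext_integral F u \<le> V u 0"
  using le_V[of u "\<lambda>_ _. 0" 0] zero_in_menu utility_measurable[of u]
  by (simp add: terminal_def split_beta' ext_integral_joint_snd)

text \<open>Some strategy comes within \<eta>/2 of the status quo at the higher price. The price cut
  adds \<eta> to every strategy, which more than covers the shortfall.\<close>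

lemma V_strict_decreasing:
  assumes u: "u \<in> utilities F" and "\<mu> < \<mu>'" and ge: "ext_integral F u \<le> V u \<mu>'"
  shows "ext_integral F u < V u \<mu>"
proof -
  obtain \<eta> where \<eta>: "0 < \<eta>"
    "\<And>\<beta>. (\<And>x. x \<in> X \<Longrightarrow> \<beta> x \<in> B) \<Longrightarrow> integrable joint (\<lambda>z. u (terminal \<beta> \<mu>' z)) \<Longrightarrow>
      ereal ((\<integral>z. u (terminal \<beta> \<mu>' z) \<partial>joint) + \<eta>) \<le> ext_integral joint (\<lambda>z. u (terminal \<beta> \<mu> z))"
    using expected_utility_price_gap[OF u \<open>\<mu> < \<mu>'\<close>] by metis
  define c where "c = (\<integral>w. u w \<partial>F) - \<eta> / 2"
  have "ereal c < ext_integral F u" using \<eta>(1) by (simp add: ext_integral_utility[OF u] c_def)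
  also note ge
  finally obtain \<beta> where \<beta>: "\<And>x. x \<in> X \<Longrightarrow> \<beta> x \<in> B"
    and lt: "ereal c < ext_integral joint (\<lambda>z. u (terminal \<beta> \<mu>' z))"
    using less_V_obtain[OF u] by metis
  note i = expected_utility_geD[of u \<beta>, OF u \<beta> less_imp_le[OF lt]]
  have "ext_integral F u < ereal ((\<integral>z. u (terminal \<beta> \<mu>' z) \<partial>joint) + \<eta>)"
    using i(2) \<eta>(1) by (simp add: ext_integral_utility[OF u] c_def)
  also have "\<dots> \<le> ext_integral joint (\<lambda>z. u (terminal \<beta> \<mu> z))" using \<beta> i(1) by (rule \<eta>(2))
  also have "\<dots> \<le> V u \<mu>" using u \<beta> by (rule le_V)
  finally show ?thesis .
qed

text \<open>Some level \<open>u a\<close> lies below the mean of \<open>u\<close>. Terminal wealth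
  is at most \<open>menu_bound + 2 * \<bar>w\<bar> - \<mu>\<close>, so as the price grows the
  expected utility of every strategy is bounded by means that tend to \<open>u a\<close>, uniformly
  over strategies.\<close>

lemma V_eventually_small:
  assumes u: "u \<in> utilities F"
  obtains N :: nat where "\<And>\<mu>. real N \<le> \<mu> \<Longrightarrow> V u \<mu> < ext_integral F u"
proof -
  have sm: "strict_mono u" and iu: "integrable F u" using u by (auto simp: utilities_def)
  have [measurable]: "u \<in> borel_measurable borel" using u by (rule utility_measurable)
  have "\<exists>a. u a < (\<integral>w. u w \<partial>F)"
  proof (rule ccontr)
    assume "\<not> ?thesis"
    then have ge: "(\<integral>w. u w \<partial>F) \<le> u a" for a by (auto simp: not_less)
    \<comment> \<open>If the mean were a lower bound of \<open>u\<close>, then strict monotonicity,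
      applied one unit further left, would make it a strict one.\<close>
    have "(\<integral>w. u w \<partial>F) < u a" for a
      using ge[of "a - 1"] strict_monoD[OF sm, of "a - 1" a] by simp
    then have "(\<integral>w. (\<integral>w. u w \<partial>F) \<partial>F) < (\<integral>w. u w \<partial>F)"
      using iu F.emeasure_space_1 by (intro F.integral_less_AE_space) auto
    then show False using F.prob_space by simp
  qed
  then obtain a where a: "u a < (\<integral>w. u w \<partial>F)" ..
  obtain C D where CD: "0 \<le> C" "0 \<le> D" "\<And>y. u y \<le> C + D * \<bar>y\<bar>"
    using utility_linear_bound[OF u] by blast
  define q where "q n w = u (menu_bound + 2 * \<bar>w\<bar> - real n)" for n w
  define k where "k w = \<bar>u a\<bar> + (C + D * (menu_bound + 2 * \<bar>w\<bar>))" for w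
  have ik: "integrable F k" unfolding k_def[abs_def] using integrable_wealth by auto
  \<comment> \<open>Cutting off at \<open>u a\<close> bounds the integrands from below too, as
    dominated convergence requires; \<open>q n w\<close> alone may tend to -\<infinity>.\<close>
  have bound: "norm (max (q n w) (u a)) \<le> k w" for n w
  proof -
    have "q n w \<le> u (menu_bound + 2 * \<bar>w\<bar>)" using sm by (simp add: q_def strict_mono_less_eq)
    also have "\<dots> \<le> C + D * (menu_bound + 2 * \<bar>w\<bar>)"
      using CD(3)[of "menu_bound + 2 * \<bar>w\<bar>"] menu_bound(1) by simp
    finally have 1: "q n w \<le> C + D * (menu_bound + 2 * \<bar>w\<bar>)" .
    have "0 \<le> C + D * (menu_bound + 2 * \<bar>w\<bar>)" using CD menu_bound(1) by simp
    with 1 show ?thesis by (auto simp: k_def max_def)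
  qed
  have "(\<lambda>n. \<integral>w. max (q n w) (u a) \<partial>F) \<longlonglongrightarrow> (\<integral>w. u a \<partial>F)"
  proof (rule integral_dominated_convergence)
    show "integrable F k" by (rule ik)
    show "AE w in F. (\<lambda>n. max (q n w) (u a)) \<longlonglongrightarrow> u a"
    proof (rule AE_I2)
      fix w
      have "eventually (\<lambda>n. menu_bound + 2 * \<bar>w\<bar> - a \<le> real n) sequentially"
        by (meson eventually_sequentiallyI nat_ceiling_le_eq)
      then have "eventually (\<lambda>n. max (q n w) (u a) = u a) sequentially"
        by eventually_elim (use sm in \<open>auto simp: q_def max_def strict_mono_less_eq\<close>)
      then show "(\<lambda>n. max (q n w) (u a)) \<longlonglongrightarrow> u a" by (rule tendsto_eventually)
    qed
    show "AE w in F. norm (max (q n w) (u a)) \<le> k w" for n using bound by (intro AE_I2)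
  qed (auto simp: q_def)
  then have "(\<lambda>n. \<integral>w. max (q n w) (u a) \<partial>F) \<longlonglongrightarrow> u a" using F.prob_space by simp
  then have "eventually (\<lambda>n. (\<integral>w. max (q n w) (u a) \<partial>F) < (\<integral>w. u w \<partial>F)) sequentially"
    using a by (rule order_tendstoD)
  then obtain N where N: "(\<integral>w. max (q N w) (u a) \<partial>F) < (\<integral>w. u w \<partial>F)"
    by (auto simp: eventually_sequentially)
  have iq: "integrable F (\<lambda>w. max (q N w) (u a))"
    using ik by (rule Bochner_Integration.integrable_bound)
      (use order_trans[OF bound abs_ge_self] in \<open>auto simp: q_def intro!: AE_I2\<close>)
  have "V u \<mu> < ext_integral F u" if "real N \<le> \<mu>" for \<mu>
  proof -
    have "V u \<mu> \<le> ext_integral F (\<lambda>w. max (q N w) (u a))"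
      unfolding max_expected_utility_eq[OF utility_measurable[OF u]]
    proof (rule SUP_least)
      fix \<beta> assume "\<beta> \<in> X \<rightarrow>\<^sub>E B"
      then have \<beta>: "x \<in> X \<Longrightarrow> \<beta> x \<in> B" for x by auto
      have "ext_integral joint (\<lambda>z. u (terminal \<beta> \<mu> z)) \<le> ext_integral joint (\<lambda>z. max (q N (snd z)) (u a))"
      proof (intro ext_integral_mono_AE AE_I2)
        fix z assume "z \<in> space joint"
        then have "terminal \<beta> \<mu> z \<le> menu_bound + 2 * \<bar>snd z\<bar> - real N"
          using menu_bound(2)[OF \<beta>, of "fst z" "snd z"] that
          by (auto simp: terminal_def space_joint split_beta')
        then have "u (terminal \<beta> \<mu> z) \<le> q N (snd z)" using sm by (simp add: q_def strict_mono_less_eq)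
        then show "u (terminal \<beta> \<mu> z) \<le> max (q N (snd z)) (u a)" by simp
      qed
      also have "\<dots> = ext_integral F (\<lambda>w. max (q N w) (u a))"
        by (rule ext_integral_joint_snd) (simp add: q_def)
      finally show "ext_integral joint (\<lambda>z. u (terminal \<beta> \<mu> z)) \<le> ext_integral F (\<lambda>w. max (q N w) (u a))" .
    qed
    also have "\<dots> < ext_integral F u"
      using N by (simp add: ext_integral_eq_integral[OF iq] ext_integral_utility[OF u])
    finally show ?thesis .
  qed
  then show thesis by (rule that)
qed

text \<open>The number is the supremum of the prices at which information is worth buying: this set
  contains 0, is bounded by \<open>V_eventually_small\<close>, and below its supremum the preference
  is strict by \<open>V_strict_decreasing\<close>. Two such numbers would put contradictory demands
  on a price between them.\<close>

lemma WTP_characterization: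
  assumes u: "u \<in> utilities F"
  shows "0 \<le> WTP F f B X h u"
    and "WTP F f B X h u < \<mu> \<Longrightarrow> V u \<mu> < ext_integral F u"
    and "0 \<le> \<mu> \<Longrightarrow> \<mu> < WTP F f B X h u \<Longrightarrow> ext_integral F u < V u \<mu>"
proof -
  define P where "P M \<longleftrightarrow> M \<ge> 0 \<and> (\<forall>\<mu>>M. V u \<mu> < ext_integral F u) \<and>
    (\<forall>\<mu>. 0 \<le> \<mu> \<and> \<mu> < M \<longrightarrow> V u \<mu> > ext_integral F u)" for M
  have "\<exists>!M. P M"
  proof (rule ex_ex1I)
    define A where "A = {\<mu>. 0 \<le> \<mu> \<and> ext_integral F u \<le> V u \<mu>}"
    obtain N :: nat where N: "\<And>\<mu>. real N \<le> \<mu> \<Longrightarrow> V u \<mu> < ext_integral F u"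
      using V_eventually_small[OF u] by blast
    have 0: "0 \<in> A" using V_at_0[OF u] by (simp add: A_def)
    have "\<mu> \<le> real N" if "\<mu> \<in> A" for \<mu>
      using that N[of \<mu>] by (force simp: A_def)
    then have bdd: "bdd_above A" by (auto simp: bdd_above_def)
    have "P (Sup A)"
      unfolding P_def
    proof (intro conjI allI impI)
      show S0: "0 \<le> Sup A" using 0 bdd by (rule cSup_upper)
      show "V u \<mu> < ext_integral F u" if "Sup A < \<mu>" for \<mu>
        using that S0 cSup_upper[OF _ bdd, of \<mu>] by (force simp: A_def)
      show "ext_integral F u < V u \<mu>" if \<mu>: "0 \<le> \<mu> \<and> \<mu> < Sup A" for \<mu>
      proof -
        obtain \<mu>' where "\<mu>' \<in> A" "\<mu> < \<mu>'" using \<mu> 0 bdd less_cSup_iff[of A \<mu>] by auto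
        then show ?thesis using V_strict_decreasing[OF u, of \<mu> \<mu>'] by (simp add: A_def)
      qed
    qed
    then show "\<exists>M. P M" ..
    have False if "P M" "P M'" "M < M'" for M M'
    proof -
      obtain \<mu> where "M < \<mu>" "\<mu> < M'" using \<open>M < M'\<close> dense by blast
      then have "V u \<mu> < ext_integral F u" "ext_integral F u < V u \<mu>"
        using that(1,2) by (auto simp: P_def)
      then show False by simp
    qed
    then show "M = M'" if "P M" "P M'" for M M' using that by (meson linorder_neqE)
  qed
  moreover have "WTP F f B X h u = (THE M. P M)" by (simp only: P_def[abs_def] WTP_def)
  ultimately have "P (WTP F f B X h u)" by (simp only: theI')
  then show "0 \<le> WTP F f B X h u"
    "WTP F f B X h u < \<mu> \<Longrightarrow> V u \<mu> < ext_integral F u"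
    "0 \<le> \<mu> \<Longrightarrow> \<mu> < WTP F f B X h u \<Longrightarrow> ext_integral F u < V u \<mu>"
    by (auto simp: P_def)
qed

end

section \<open>Insurance menus with a pivot\<close>

text \<open>
  \<open>dominates r b' b\<close> is the order \<open>b' \<succeq> b\<close> of an insurance menu with pivot \<open>w\<^sup>* = r\<close>, made
  independent of the choice of the relation witnessing it.
\<close>

definition dominates :: "real \<Rightarrow> (real \<Rightarrow> real) \<Rightarrow> (real \<Rightarrow> real) \<Rightarrow> bool" where
  "dominates r b' b \<longleftrightarrow> (\<forall>w\<le>r. b w \<le> b' w) \<and> (\<forall>w\<ge>r. b' w \<le> b w)"

lemma dominates_trans: "dominates r b'' b' \<Longrightarrow> dominates r b' b \<Longrightarrow> dominates r b'' b"
  by (auto simp: dominates_def intro: order_trans)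

context information_environment
begin

lemma AE_F_iff: "(AE w in F. P w) \<longleftrightarrow> (AE w in lborel. 0 < f w \<longrightarrow> P w)"
  unfolding F_eq by (subst AE_density) auto

text \<open>The asset can only raise utility, while (ZAZI) forbids a higher mean. So the nonnegative
  utility gain has mean 0 and vanishes almost everywhere, and strict monotonicity makes the asset
  vanish too.\<close>

lemma ZAZI_nonneg_asset_null:
  assumes u: "u \<in> utilities F" and zazi: "ZAZI F B u" and b: "b \<in> B" and nonneg: "AE w in F. 0 \<le> b w"
  shows "AE w in F. b w = 0"
proof -
  have sm: "strict_mono u" and iu: "integrable F u" using u by (auto simp: utilities_def)
  have [measurable]: "u \<in> borel_measurable borel" using u by (rule utility_measurable)
  have [measurable]: "b \<in> borel_measurable borel" using b by (rule menu_measurable)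
  obtain C D where CD: "0 \<le> C" "0 \<le> D" "\<And>y. u y \<le> C + D * \<bar>y\<bar>"
    using utility_linear_bound[OF u] by blast
  have ge: "AE w in F. u w \<le> u (w + b w)"
    using nonneg by eventually_elim (use sm in \<open>simp add: strict_mono_less_eq\<close>)
  have "ext_integral F u \<le> ext_integral F (\<lambda>w. u (w + b w))"
    using ge by (rule ext_integral_mono_AE)
  moreover have le: "ext_integral F (\<lambda>w. u (w + b w)) \<le> ext_integral F u"
    using zazi b by (auto simp: ZAZI_def is_arg_max_def not_less)
  ultimately have "ereal (\<integral>w. u w \<partial>F) \<le> ext_integral F (\<lambda>w. u (w + b w))"
    by (simp add: ext_integral_utility[OF u])
  moreover have "AE w in F. u (w + b w) \<le> C + D * (menu_bound + 2 * \<bar>w\<bar>)"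
  proof (rule AE_I2)
    fix w
    have "D * \<bar>w + b w\<bar> \<le> D * (menu_bound + 2 * \<bar>w\<bar>)"
      using menu_bound(2)[OF b, of w] CD(2) by (intro mult_left_mono) auto
    then show "u (w + b w) \<le> C + D * (menu_bound + 2 * \<bar>w\<bar>)" using CD(3)[of "w + b w"] by linarith
  qed
  moreover have "integrable F (\<lambda>w. C + D * (menu_bound + 2 * \<bar>w\<bar>))" using integrable_wealth by auto
  ultimately have iY: "integrable F (\<lambda>w. u (w + b w))"
    by (intro ext_integral_geD(1)[of "\<lambda>w. u (w + b w)" F "\<lambda>w. C + D * (menu_bound + 2 * \<bar>w\<bar>)"]) auto
  then have "(\<integral>w. u (w + b w) \<partial>F) \<le> (\<integral>w. u w \<partial>F)"
    using le by (simp add: ext_integral_utility[OF u] ext_integral_eq_integral)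
  moreover have "(\<integral>w. u w \<partial>F) \<le> (\<integral>w. u (w + b w) \<partial>F)"
    using iu iY ge by (rule integral_mono_AE)
  ultimately have "(\<integral>w. u (w + b w) - u w \<partial>F) = 0" using iu iY by simp
  then have "AE w in F. u (w + b w) - u w = 0"
    using iu iY ge by (subst (asm) integral_nonneg_eq_0_iff_AE) auto
  then show ?thesis
    by eventually_elim (use sm in \<open>simp add: strict_mono_eq\<close>)
qed

lemma V_le_of_nonpositive_menu:
  assumes u: "u \<in> utilities F" and "0 \<le> \<mu>" and nonpos: "\<And>b. b \<in> B \<Longrightarrow> AE w in F. b w \<le> 0"
  shows "V u \<mu> \<le> ext_integral F u"
  unfolding max_expected_utility_eq[OF utility_measurable[OF u]]
proof (rule SUP_least)
  fix \<beta> assume "\<beta> \<in> X \<rightarrow>\<^sub>E B"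
  then have \<beta>: "x \<in> X \<Longrightarrow> \<beta> x \<in> B" for x by auto
  have sm: "strict_mono u" using u by (auto simp: utilities_def)
  have "AE w in F. \<forall>x\<in>X. \<beta> x w \<le> 0"
    using finite_signals \<beta> nonpos by (simp add: AE_finite_all)
  then have "AE z in joint. \<forall>x\<in>X. \<beta> x (snd z) \<le> 0" by (rule AE_joint_snd)
  then have "AE z in joint. u (terminal \<beta> \<mu> z) \<le> u (snd z)"
    using AE_space
  proof eventually_elim
    case (elim z)
    then have "\<beta> (fst z) (snd z) \<le> 0" by (auto simp: space_joint)
    then show ?case using \<open>0 \<le> \<mu>\<close> sm by (simp add: terminal_def split_beta' strict_mono_less_eq)
  qed
  then have "ext_integral joint (\<lambda>z. u (terminal \<beta> \<mu> z)) \<le> ext_integral joint (\<lambda>z. u (snd z))"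
    by (rule ext_integral_mono_AE)
  then show "ext_integral joint (\<lambda>z. u (terminal \<beta> \<mu> z)) \<le> ext_integral F u"
    using utility_measurable[OF u] by (simp add: ext_integral_joint_snd)
qed

text \<open>Comparison with the zero asset fixes the sign of every asset on each side of the pivot.
  If the pivot is infinite, or finite but with \<open>f\<close> vanishing somewhere below it, only
  one side carries mass.\<close>

lemma insurance_pivot_cases:
  obtains (degenerate) "\<And>b. b \<in> B \<Longrightarrow> (AE w in F. 0 \<le> b w) \<or> (AE w in F. b w \<le> 0)"
  | (pivot) r where "\<And>w. w < r \<Longrightarrow> 0 < f w"
      "\<And>b b'. b \<in> B \<Longrightarrow> b' \<in> B \<Longrightarrow> dominates r b b' \<or> dominates r b' b"
      "\<And>b. b \<in> B \<Longrightarrow> dominates r b (\<lambda>_. 0)"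
proof -
  obtain w0 :: ereal and R where
    total: "\<forall>b\<in>B. \<forall>b'\<in>B. R b b' \<or> R b' b"
    and order: "\<forall>b\<in>B. \<forall>b'\<in>B. R b' b \<longrightarrow>
      (\<forall>w. ereal w \<le> w0 \<longrightarrow> b' w \<ge> b w) \<and> (\<forall>w. ereal w \<ge> w0 \<longrightarrow> b' w \<le> b w)"
    using insurances unfolding insurance_menu_def by (elim conjE exE) (rule that)
  have above: "b w \<le> b' w" if "b \<in> B" "b' \<in> B" "R b' b" "ereal w \<le> w0" for b b' w
    using order that by blast
  have below: "b' w \<le> b w" if "b \<in> B" "b' \<in> B" "R b' b" "w0 \<le> ereal w" for b b' w
    using order that by blast
  have zero: "R b (\<lambda>_. 0) \<or> R (\<lambda>_. 0) b" if "b \<in> B" for b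
    using total that zero_in_menu by blast
  note cmp = above[OF _ zero_in_menu] below[OF _ zero_in_menu]
    above[OF zero_in_menu] below[OF zero_in_menu]
  show thesis
  proof (cases w0)
    case PInf
    have "(\<forall>w. 0 \<le> b w) \<or> (\<forall>w. b w \<le> 0)" if "b \<in> B" for b
      using zero[OF that] cmp that by (auto simp: PInf)
    then show ?thesis by (intro degenerate) (meson AE_I2)
  next
    case MInf
    have "(\<forall>w. 0 \<le> b w) \<or> (\<forall>w. b w \<le> 0)" if "b \<in> B" for b
      using zero[OF that] cmp that by (auto simp: MInf)
    then show ?thesis by (intro degenerate) (meson AE_I2)
  next
    case (real r)
    show ?thesis
    proof (cases "\<forall>w<r. 0 < f w")
      case True
      show ?thesis
      proof (rule pivot)
        show "0 < f w" if "w < r" for w using True that by blast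
        show "dominates r b b' \<or> dominates r b' b" if "b \<in> B" "b' \<in> B" for b b'
        proof -
          have "dominates r b b'" if "R b b'" "b \<in> B" "b' \<in> B" for b b'
            using above[OF that(3,2,1)] below[OF that(3,2,1)] by (simp add: dominates_def real)
          then show ?thesis using total that by blast
        qed
        show "dominates r b (\<lambda>_. 0)" if b: "b \<in> B" for b
          using zero[OF b]
        proof
          assume "R b (\<lambda>_. 0)"
          then show ?thesis using cmp b by (auto simp: dominates_def real)
        next
          \<comment> \<open>Here \<open>b\<close> is at most 0 below and at least 0 above the pivot.
            Being nonincreasing with value 0 at \<open>r\<close>, it has the reverse signs as well,
            so it is the zero map.\<close>
          assume *: "R (\<lambda>_. 0) b"
          then have "b r \<le> 0" "0 \<le> b r" using cmp(1)[OF b *, of r] cmp(2)[OF b *, of r] by (auto simp: real)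
          then show ?thesis
            using menu_antimono[OF b, of r] menu_antimono[OF b, of _ r]
            by (auto simp: dominates_def intro: order_trans)
        qed
      qed
    next
      case False
      then obtain w1 where w1: "w1 < r" "\<not> 0 < f w1" by auto
      \<comment> \<open>The set where \<open>f\<close> is positive is an interval unbounded below
        that misses \<open>w1\<close>, so it lies to the left of \<open>w1\<close>.\<close>
      have S: "w < w1" if "0 < f w" for w
      proof (rule ccontr)
        assume "\<not> w < w1"
        obtain w2 where w2: "0 < f w2" "w2 < w1"
          using log_convex unfolding downward_log_convex_def bdd_below_def
          by (metis (mono_tags, lifting) mem_Collect_eq not_le)
        have "is_interval {w. f w > 0}"
          using log_convex by (simp add: downward_log_convex_def is_interval_convex_1)
        then have "w1 \<in> {w. f w > 0}"
          by (rule mem_is_interval_1_I[of _ w2 w]) (use that w2 \<open>\<not> w < w1\<close> in auto)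
        then show False using w1(2) by simp
      qed
      have low: "AE w in F. w \<le> r"
        unfolding AE_F_iff using S w1(1) by (auto intro!: AE_I2 dest!: S)
      show ?thesis
      proof (rule degenerate)
        fix b assume b: "b \<in> B"
        from zero[OF b] show "(AE w in F. 0 \<le> b w) \<or> (AE w in F. b w \<le> 0)"
        proof
          assume "R b (\<lambda>_. 0)"
          then have "AE w in F. 0 \<le> b w" using low cmp(3)[OF b] by (auto simp: real elim!: eventually_mono)
          then show ?thesis ..
        next
          assume "R (\<lambda>_. 0) b"
          then have "AE w in F. b w \<le> 0" using low cmp(1)[OF b] by (auto simp: real elim!: eventually_mono)
          then show ?thesis ..
        qed
      qed
    qed
  qed
qed

end

section \<open>Environments with a real pivot and positive density below it\<close>

locale pivotal_environment = information_environment +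
  fixes r :: real
  assumes density_pos: "w < r \<Longrightarrow> 0 < f w"
    and dominates_total: "b \<in> B \<Longrightarrow> b' \<in> B \<Longrightarrow> dominates r b b' \<or> dominates r b' b"
    and dominates_zero: "b \<in> B \<Longrightarrow> dominates r b (\<lambda>_. 0)"
begin

lemma asset_nonneg: "b \<in> B \<Longrightarrow> w \<le> r \<Longrightarrow> 0 \<le> b w"
  and asset_nonpos: "b \<in> B \<Longrightarrow> r \<le> w \<Longrightarrow> b w \<le> 0"
  using dominates_zero by (auto simp: dominates_def)

lemma asset_pivot: "b \<in> B \<Longrightarrow> b r = 0"
  using asset_nonneg asset_nonpos by (intro antisym) auto

lemma wealth_above_pivot: "b \<in> B \<Longrightarrow> r \<le> w \<Longrightarrow> r \<le> w + b w"
  using menu_wealth_mono[of b r w] asset_pivot[of b] by simp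

text \<open>In cross-multiplied form, \<open>f (w + d) / f w\<close> is nondecreasing in
  \<open>w\<close>. The points \<open>a + d\<close> and \<open>c\<close> lie between
  \<open>a\<close> and \<open>c + d\<close> and have the same sum, so convexity of
  \<open>ln f\<close> at both, with swapped weights, gives the inequality.\<close>

lemma density_ratio_mono:
  assumes "a \<le> c" "0 \<le> d" "c + d < r"
  shows "f c * f (a + d) \<le> f a * f (c + d)"
proof (cases "a = c")
  case False
  have cv: "convex_on {w. f w > 0} (\<lambda>w. ln (f w))" using log_convex by (simp add: downward_log_convex_def)
  have pos: "0 < f a" "0 < f c" "0 < f (a + d)" "0 < f (c + d)" using assms density_pos by auto
  define t where "t = d / (c + d - a)"
  have *: "0 < c + d - a" using False assms by simp
  then have t: "0 \<le> t" "t \<le> 1" "t * (c + d - a) = d" using assms by (auto simp: t_def)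
  have e: "a + d = (1 - t) * a + t * (c + d)" "c = t * a + (1 - t) * (c + d)"
    using t(3) by (auto simp: algebra_simps)
  have "ln (f (a + d)) \<le> (1 - t) * ln (f a) + t * ln (f (c + d))"
    using convex_onD[OF cv t(1,2), of a "c + d"] pos by (simp add: e(1)[symmetric])
  moreover have "ln (f c) \<le> t * ln (f a) + (1 - t) * ln (f (c + d))"
    using convex_onD[OF cv, of "1 - t" a "c + d"] t(1,2) pos by (simp add: e(2)[symmetric])
  ultimately have "ln (f c) + ln (f (a + d)) \<le> ln (f a) + ln (f (c + d))"
    by (simp add: algebra_simps)
  then have "ln (f c * f (a + d)) \<le> ln (f a * f (c + d))" using pos by (simp add: ln_mult)
  then show ?thesis using pos by simp
qed simp

text \<open>
  Log convexity bounds the ratio \<open>f (w + \<mu>) / f w\<close> as \<open>w \<rightarrow> -\<infinity>\<close>, so paying the price \<open>\<mu>\<close>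
  does not destroy integrability.
\<close>

lemma integrable_utility_shift:
  assumes u: "u \<in> utilities F" and "0 \<le> \<mu>"
  shows "integrable F (\<lambda>w. u (min w r - \<mu>))"
proof -
  have sm: "strict_mono u" and iu: "integrable F u" using u by (auto simp: utilities_def)
  have [measurable]: "u \<in> borel_measurable borel" using u by (rule utility_measurable)
  \<comment> \<open>Chosen so that \<open>z + \<mu>\<close> is below the pivot; the ratio
    \<open>k\<close> at \<open>z\<close> then bounds the ratios at all points to its left.\<close>
  define z where "z = r - \<mu> - 1"
  define k where "k = f (z + \<mu>) / f z"
  have fz: "0 < f z" using \<open>0 \<le> \<mu>\<close> by (intro density_pos) (simp add: z_def)
  have ratio: "f (w + \<mu>) \<le> k * f w" if "w \<le> z" for w
    using density_ratio_mono[OF that \<open>0 \<le> \<mu>\<close>] fz by (simp add: k_def z_def field_simps)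
  have k: "0 \<le> k" using density_nonneg by (simp add: k_def)
  have "integrable lborel (\<lambda>w. f w * u w)"
    using iu unfolding F_eq by (subst (asm) integrable_density) (auto simp: density_nonneg)
  then have "integrable lborel (\<lambda>w. k * (f w * u w))" by simp
  then have "integrable lborel (\<lambda>w. f (w + \<mu>) * (indicator {..z} w * u w))"
  proof (rule Bochner_Integration.integrable_bound)
    show "AE w in lborel. norm (f (w + \<mu>) * (indicator {..z} w * u w)) \<le> norm (k * (f w * u w))"
    proof (rule AE_I2)
      fix w
      show "norm (f (w + \<mu>) * (indicator {..z} w * u w)) \<le> norm (k * (f w * u w))"
        using ratio[of w] density_nonneg k
        by (auto simp: indicator_def abs_mult mult.assoc[symmetric] intro!: mult_right_mono)
    qed
  qed measurable
  \<comment> \<open>Translation moves the shift by \<mu> from the density onto the utility.\<close>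
  from lborel_integrable_real_affine[OF this, of 1 "- \<mu>"]
  have "integrable lborel (\<lambda>w. f w * (indicator {..z} (w - \<mu>) * u (w - \<mu>)))"
    by (simp add: add.commute)
  then have i: "integrable F (\<lambda>w. indicator {..z} (w - \<mu>) * u (w - \<mu>))"
    unfolding F_eq by (subst integrable_density) (auto simp: density_nonneg)
  \<comment> \<open>For w > r - 1 the argument of \<open>u\<close> stays in an interval of length 1,
    where monotonicity bounds \<open>u\<close> by its values at the ends.\<close>
  define c where "c = \<bar>u (r - 1 - \<mu>)\<bar> + \<bar>u (r - \<mu>)\<bar>"
  have "integrable F (\<lambda>w. c + \<bar>indicator {..z} (w - \<mu>) * u (w - \<mu>)\<bar>)" using i by simp
  then show ?thesis
  proof (rule Bochner_Integration.integrable_bound)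
    show "AE w in F. norm (u (min w r - \<mu>)) \<le> norm (c + \<bar>indicator {..z} (w - \<mu>) * u (w - \<mu>)\<bar>)"
    proof (rule AE_I2)
      fix w
      show "norm (u (min w r - \<mu>)) \<le> norm (c + \<bar>indicator {..z} (w - \<mu>) * u (w - \<mu>)\<bar>)"
      proof (cases "w \<le> r - 1")
        case True
        then show ?thesis by (auto simp: c_def z_def)
      next
        case False
        then have "u (r - 1 - \<mu>) \<le> u (min w r - \<mu>)" "u (min w r - \<mu>) \<le> u (r - \<mu>)"
          using sm by (auto simp: strict_mono_less_eq)
        then have "\<bar>u (min w r - \<mu>)\<bar> \<le> c" by (auto simp: c_def)
        then show ?thesis by auto
      qed
    qed
  qed measurable
qed

text \<open>Terminal wealth is at least \<open>min w r - \<mu>\<close>: assets pay a nonnegative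
  amount below the pivot, and above it wealth after the transfer stays at least \<open>r\<close>.
  The shifted utility is thus an integrable lower bound.\<close>

lemma integrable_expected_utility:
  assumes u: "u \<in> utilities F" and "0 \<le> \<mu>" and \<beta>: "\<And>x. x \<in> X \<Longrightarrow> \<beta> x \<in> B"
  shows "integrable joint (\<lambda>z. u (terminal \<beta> \<mu> z))"
proof -
  have sm: "strict_mono u" using u by (auto simp: utilities_def)
  have i: "integrable joint (\<lambda>z. u (min (snd z) r - \<mu>))"
    by (rule integrable_joint_snd[OF integrable_utility_shift[OF u \<open>0 \<le> \<mu>\<close>]])
  have "ereal (\<integral>z. u (min (snd z) r - \<mu>) \<partial>joint) = ext_integral joint (\<lambda>z. u (min (snd z) r - \<mu>))"
    using i by (rule ext_integral_eq_integral[symmetric])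
  also have "\<dots> \<le> ext_integral joint (\<lambda>z. u (terminal \<beta> \<mu> z))"
  proof (intro ext_integral_mono_AE AE_I2)
    fix z assume "z \<in> space joint"
    then have "\<beta> (fst z) \<in> B" using \<beta> by (auto simp: space_joint)
    then have "min (snd z) r \<le> snd z + \<beta> (fst z) (snd z)"
      using asset_nonneg[of "\<beta> (fst z)" "snd z"] wealth_above_pivot[of "\<beta> (fst z)" "snd z"]
      by (cases "snd z \<le> r") auto
    then show "u (min (snd z) r - \<mu>) \<le> u (terminal \<beta> \<mu> z)"
      using sm by (simp add: terminal_def split_beta' strict_mono_less_eq)
  qed
  finally show ?thesis using expected_utility_geD(1)[of u \<beta>, OF u \<beta>] by blast
qed

end

section \<open>Monotone selection of maximizers\<close>

lemma dominates_antisym: "dominates r b b' \<Longrightarrow> dominates r b' b \<Longrightarrow> b = b'"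
proof
  fix w assume "dominates r b b'" "dominates r b' b"
  then show "b w = b' w" by (cases "w \<le> r") (auto simp: dominates_def intro: antisym)
qed

lemma finite_total_has_greatest:
  assumes "finite A" "A \<noteq> {}"
    and "\<And>a b. a \<in> A \<Longrightarrow> b \<in> A \<Longrightarrow> R a b \<or> R b a"
    and "\<And>a b c. R a b \<Longrightarrow> R b c \<Longrightarrow> R a c"
  shows "\<exists>m\<in>A. \<forall>a\<in>A. R m a"
  using assms(1-3)
proof (induction A rule: finite_ne_induct)
  case (insert a A)
  then obtain m where m: "m \<in> A" "\<forall>a\<in>A. R m a" by auto
  have aa: "R a a" using insert.prems[of a a] by simp
  consider "R m a" | "R a m" using insert.prems[of m a] m(1) by auto
  then show ?case
  proof cases
    case 1 then show ?thesis using m by auto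
  next
    case 2 then show ?thesis using m(2) aa assms(4)[OF 2] by auto
  qed
qed auto

text \<open>
  The smallest of the greatest maximizers at signals below \<open>x\<close> is still a maximizer at \<open>x\<close>.
  Taking greatest (or smallest) maximizers alone need not be monotone, since single crossing is
  only assumed in a weak form.
\<close>

lemma monotone_maximizer_selection:
  fixes J :: "'a::linorder \<Rightarrow> 'b \<Rightarrow> 'c::linorder"
  assumes "finite X" "finite C" "C \<noteq> {}"
    and total: "\<And>b c. b \<in> C \<Longrightarrow> c \<in> C \<Longrightarrow> R b c \<or> R c b"
    and trans: "\<And>a b c. R a b \<Longrightarrow> R b c \<Longrightarrow> R a c"
    and antisym: "\<And>a b. R a b \<Longrightarrow> R b a \<Longrightarrow> a = b"
    and crossing: "\<And>x y b c. x \<in> X \<Longrightarrow> y \<in> X \<Longrightarrow> x \<le> y \<Longrightarrow> b \<in> C \<Longrightarrow> c \<in> C \<Longrightarrow> R c b \<Longrightarrow>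
      J x c < J x b \<Longrightarrow> J y c \<le> J y b"
  obtains \<gamma> where "\<And>x. x \<in> X \<Longrightarrow> \<gamma> x \<in> C" "\<And>x b. x \<in> X \<Longrightarrow> b \<in> C \<Longrightarrow> J x b \<le> J x (\<gamma> x)"
    "\<And>x y. x \<in> X \<Longrightarrow> y \<in> X \<Longrightarrow> x \<le> y \<Longrightarrow> R (\<gamma> x) (\<gamma> y)"
proof -
  define A where "A x = {b \<in> C. \<forall>c\<in>C. J x c \<le> J x b}" for x
  have "\<exists>m\<in>C. \<forall>c\<in>C. J x c \<le> J x m" for x
    by (rule finite_total_has_greatest[OF assms(2,3)]) auto
  then have A_ne: "A x \<noteq> {}" for x by (auto simp: A_def)
  have "\<exists>m\<in>A x. \<forall>a\<in>A x. R m a" for x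
  proof (rule finite_total_has_greatest[OF _ A_ne])
    show "finite (A x)" using \<open>finite C\<close> by (simp add: A_def)
    show "R a b \<or> R b a" if "a \<in> A x" "b \<in> A x" for a b
      using that by (intro total) (auto simp: A_def)
  qed (rule trans)
  then obtain g where g: "\<And>x. g x \<in> A x" "\<And>x a. a \<in> A x \<Longrightarrow> R (g x) a" by metis
  have gC: "g x \<in> C" for x using g(1) by (auto simp: A_def)
  \<comment> \<open>These sets grow with \<open>x\<close>, so their least elements decrease, which
    makes \<gamma> monotone.\<close>
  define G where "G x = g ` {y \<in> X. y \<le> x}" for x
  have "\<exists>m\<in>G x. \<forall>a\<in>G x. R a m" if "x \<in> X" for x
  proof (rule finite_total_has_greatest[where R="\<lambda>a b. R b a"])
    show "finite (G x)" "G x \<noteq> {}" using that \<open>finite X\<close> by (auto simp: G_def)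
    show "R b a \<or> R a b" if "a \<in> G x" "b \<in> G x" for a b
      using that gC by (intro total) (auto simp: G_def)
    show "R c a" if "R b a" "R c b" for a b c using that(2,1) by (rule trans)
  qed
  then obtain \<gamma> where \<gamma>: "\<And>x. x \<in> X \<Longrightarrow> \<gamma> x \<in> G x" "\<And>x a. x \<in> X \<Longrightarrow> a \<in> G x \<Longrightarrow> R a (\<gamma> x)"
    by metis
  have opt: "\<gamma> x \<in> A x" if x: "x \<in> X" for x
  proof -
    obtain y where y: "y \<in> X" "y \<le> x" "\<gamma> x = g y" using \<gamma>(1)[OF x] by (auto simp: G_def)
    have R: "R (g x) (g y)" using \<gamma>(2)[OF x, of "g x"] x y by (auto simp: G_def)
    show ?thesis
    \<comment> \<open>A strict preference for \<open>g y\<close> at \<open>y\<close> carries over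
      weakly to \<open>x\<close>. Otherwise \<open>g x\<close> is also maximal at \<open>y\<close>,
      so it lies below the greatest maximizer \<open>g y\<close> and the two coincide.\<close>
    proof (cases "J y (g x) < J y (g y)")
      case True
      then have "J x (g x) \<le> J x (g y)" using crossing[OF y(1) x y(2) gC gC R] by blast
      then show ?thesis using g(1)[of x] gC y(3) by (auto simp: A_def intro: order_trans)
    next
      case False
      then have "g x \<in> A y" using g(1)[of y] gC by (auto simp: A_def intro: order_trans)
      then have "g x = g y" using g(2) R antisym by blast
      then show ?thesis using g(1)[of x] y(3) by simp
    qed
  qed
  show thesis
  proof (rule that)
    show "\<gamma> x \<in> C" if "x \<in> X" for x using opt[OF that] by (simp add: A_def)
    show "J x b \<le> J x (\<gamma> x)" if "x \<in> X" "b \<in> C" for x b using opt[OF that(1)] that(2) by (simp add: A_def)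
    show "R (\<gamma> x) (\<gamma> y)" if "x \<in> X" "y \<in> X" "x \<le> y" for x y
      using \<gamma>(1)[OF that(1)] that by (intro \<gamma>(2)) (auto simp: G_def)
  qed
qed

section \<open>Single crossing in the signal and monotone strategies\<close>

context pivotal_environment
begin

text \<open>Left without division by \<open>signal_prob\<close>, so that expected utility is the
  plain sum over signals; the maximizers at a signal are the same.\<close>

definition signal_value :: "(real \<Rightarrow> real) \<Rightarrow> real \<Rightarrow> real \<Rightarrow> (real \<Rightarrow> real) \<Rightarrow> real" where
  "signal_value u \<mu> x b = (\<integral>w. pmf (h w) x * u (w + b w - \<mu>) \<partial>F)"

lemma expected_utility_eq_sum:
  assumes "u \<in> utilities F" "0 \<le> \<mu>" "\<And>x. x \<in> X \<Longrightarrow> \<beta> x \<in> B"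
  shows "(\<integral>z. u (terminal \<beta> \<mu> z) \<partial>joint) = (\<Sum>x\<in>X. signal_value u \<mu> x (\<beta> x))"
  using integral_joint(1)[OF integrable_expected_utility[of u \<mu> \<beta>, OF assms]]
  by (simp add: signal_value_def terminal_def)

lemma integrable_signal_value:
  assumes "u \<in> utilities F" "0 \<le> \<mu>" "x \<in> X" "b \<in> B"
  shows "integrable F (\<lambda>w. pmf (h w) x * u (w + b w - \<mu>))"
  using integral_joint(2)[OF integrable_expected_utility[of u \<mu> "\<lambda>_. b"] assms(3)] assms
  by (simp add: terminal_def)

text \<open>Moving from \<open>b\<close> to \<open>b'\<close> gains \<open>lo\<close> below the
  pivot and costs \<open>hi\<close> above it, with signal-weighted means \<open>P\<close> and
  \<open>Q\<close>. A higher signal shifts weight upwards, so costs grow relative to gains: Q x P x'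
  \<le> Q x' P x. If costs exceed gains at \<open>x\<close>, gains cannot exceed costs at
  \<open>x'\<close>.\<close>

lemma signal_value_single_crossing:
  assumes u: "u \<in> utilities F" and \<mu>: "0 \<le> \<mu>" and x: "x \<in> X" "x' \<in> X" "x \<le> x'"
    and b: "b \<in> B" "b' \<in> B" "dominates r b' b"
    and less: "signal_value u \<mu> x b' < signal_value u \<mu> x b"
  shows "signal_value u \<mu> x' b' \<le> signal_value u \<mu> x' b"
proof -
  have sm: "strict_mono u" using u by (auto simp: utilities_def)
  define d where "d w = u (w + b' w - \<mu>) - u (w + b w - \<mu>)" for w
  define lo where "lo w = indicator {..r} w * d w" for w
  define hi where "hi w = indicator {r<..} w * - d w" for w
  have lo0: "0 \<le> lo w" and hi0: "0 \<le> hi w" for w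
    using b(3) sm by (auto simp: lo_def hi_def d_def dominates_def indicator_def strict_mono_less_eq)
  have id: "integrable F (\<lambda>w. pmf (h w) y * d w)" if "y \<in> X" for y
    using Bochner_Integration.integrable_diff[OF integrable_signal_value[OF u \<mu> that b(2)]
        integrable_signal_value[OF u \<mu> that b(1)]]
    by (simp add: d_def algebra_simps)
  have il: "integrable F (\<lambda>w. pmf (h w) y * lo w)" if "y \<in> X" for y
    using integrable_mult_indicator[OF _ id[OF that], of "{..r}"] by (simp add: lo_def mult_ac)
  have ih: "integrable F (\<lambda>w. pmf (h w) y * hi w)" if "y \<in> X" for y
    using integrable_mult_indicator[OF _ id[OF that], of "{r<..}"]
    by (simp add: hi_def mult_ac)
  define P where "P y = (\<integral>w. pmf (h w) y * lo w \<partial>F)" for y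
  define Q where "Q y = (\<integral>w. pmf (h w) y * hi w \<partial>F)" for y
  have diff: "signal_value u \<mu> y b' - signal_value u \<mu> y b = P y - Q y" if "y \<in> X" for y
  proof -
    have "signal_value u \<mu> y b' - signal_value u \<mu> y b = (\<integral>w. pmf (h w) y * d w \<partial>F)"
      unfolding signal_value_def
      using Bochner_Integration.integral_diff[OF integrable_signal_value[OF u \<mu> that b(2)]
          integrable_signal_value[OF u \<mu> that b(1)]]
      by (simp add: d_def algebra_simps)
    also have "\<dots> = (\<integral>w. pmf (h w) y * lo w - pmf (h w) y * hi w \<partial>F)"
      by (intro Bochner_Integration.integral_cong) (auto simp: lo_def hi_def indicator_def)
    also have "\<dots> = P y - Q y" unfolding P_def Q_def
      using il[OF that] ih[OF that] by (rule Bochner_Integration.integral_diff)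
    finally show ?thesis .
  qed
  have nonneg: "0 \<le> P y" "0 \<le> Q y" for y
    unfolding P_def Q_def using lo0 hi0 by (auto intro!: integral_nonneg_AE)
  \<comment> \<open>The MLR inequality for w \<le> r < w' is integrated first over \<open>w\<close>
    with weight \<open>lo\<close>, then over \<open>w'\<close> with weight
    \<open>hi\<close>.\<close>
  have 1: "pmf (h w') x * P x' \<le> pmf (h w') x' * P x" if "r < w'" for w'
    unfolding P_def integral_mult_right_zero[symmetric]
  proof (intro integral_mono integrable_mult_right il x)
    fix w
    have "pmf (h w') x * pmf (h w) x' * lo w \<le> pmf (h w') x' * pmf (h w) x * lo w"
    proof (cases "w \<le> r")
      case True
      then show ?thesis using MLR[of w w' x x'] that x lo0
        by (intro mult_right_mono) (auto simp: mult.commute)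
    qed (simp add: lo_def)
    then show "pmf (h w') x * (pmf (h w) x' * lo w) \<le> pmf (h w') x' * (pmf (h w) x * lo w)"
      by (simp add: mult.assoc)
  qed
  have "Q x * P x' \<le> Q x' * P x"
    unfolding Q_def integral_mult_left_zero[symmetric]
  proof (intro integral_mono integrable_mult_left ih x)
    fix w
    have "hi w * (pmf (h w) x * P x') \<le> hi w * (pmf (h w) x' * P x)"
    proof (cases "r < w")
      case True
      then show ?thesis using 1[OF True] hi0 by (intro mult_left_mono) auto
    qed (simp add: hi_def)
    then show "pmf (h w) x * hi w * P x' \<le> pmf (h w) x' * hi w * P x"
      by (simp add: mult_ac)
  qed
  have "P x' \<le> Q x'"
  proof (rule ccontr)
    assume "\<not> P x' \<le> Q x'"
    moreover have "P x < Q x" using less diff[OF x(1)] by simp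
    ultimately have "Q x' * P x \<le> Q x' * Q x" "Q x' * Q x < P x' * Q x"
      using nonneg by (auto intro!: mult_left_mono mult_strict_right_mono intro: le_less_trans)
    then show False using \<open>Q x * P x' \<le> Q x' * P x\<close> by (simp add: mult.commute)
  qed
  then show ?thesis using diff[OF x(2)] by simp
qed

text \<open>At each signal the new asset is optimal among the finitely many assets that \<beta>
  uses, so nothing is lost at any signal; single crossing allows the choice to be monotone.\<close>

lemma monotone_strategy:
  assumes u: "u \<in> utilities F" and \<mu>: "0 \<le> \<mu>" and \<beta>: "\<And>x. x \<in> X \<Longrightarrow> \<beta> x \<in> B"
  obtains \<gamma> where "\<And>x. x \<in> X \<Longrightarrow> \<gamma> x \<in> B"
    "\<And>x x'. x \<in> X \<Longrightarrow> x' \<in> X \<Longrightarrow> x \<le> x' \<Longrightarrow> dominates r (\<gamma> x) (\<gamma> x')"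
    "(\<integral>z. u (terminal \<beta> \<mu> z) \<partial>joint) \<le> (\<integral>z. u (terminal \<gamma> \<mu> z) \<partial>joint)"
proof -
  have sub: "\<beta> ` X \<subseteq> B" using \<beta> by auto
  have "X \<noteq> {}" using sum_signals by (metis sum.empty zero_neq_one)
  then obtain \<gamma> where \<gamma>: "\<And>x. x \<in> X \<Longrightarrow> \<gamma> x \<in> \<beta> ` X"
    "\<And>x b. x \<in> X \<Longrightarrow> b \<in> \<beta> ` X \<Longrightarrow> signal_value u \<mu> x b \<le> signal_value u \<mu> x (\<gamma> x)"
    "\<And>x x'. x \<in> X \<Longrightarrow> x' \<in> X \<Longrightarrow> x \<le> x' \<Longrightarrow> dominates r (\<gamma> x) (\<gamma> x')"
    using monotone_maximizer_selection[of X "\<beta> ` X" "dominates r" "signal_value u \<mu>"]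
      finite_signals dominates_total sub signal_value_single_crossing[OF u \<mu>]
      dominates_trans dominates_antisym
    by (smt (verit, del_insts) finite_imageI image_is_empty subset_iff)
  then have "\<gamma> x \<in> B" if "x \<in> X" for x using sub that by blast
  moreover from this have "(\<integral>z. u (terminal \<beta> \<mu> z) \<partial>joint) \<le> (\<integral>z. u (terminal \<gamma> \<mu> z) \<partial>joint)"
    using expected_utility_eq_sum[of u \<mu> \<beta>, OF u \<mu> \<beta>] expected_utility_eq_sum[of u \<mu> \<gamma>, OF u \<mu>] \<gamma>(2)
    by (auto intro!: sum_mono)
  ultimately show thesis using \<gamma>(3) by (intro that)
qed

subsection \<open>Single crossing of the wealth distributions\<close>

text \<open>With Y for terminal wealth and W for background wealth this is P (Y \<le> m | W = w) - 1
  (w \<le> m); its mean is the difference of the two cdfs at \<open>m\<close>.\<close>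

definition excess :: "(real \<Rightarrow> real \<Rightarrow> real) \<Rightarrow> real \<Rightarrow> real \<Rightarrow> real \<Rightarrow> real" where
  "excess \<beta> \<mu> m w =
     (\<Sum>x\<in>X. pmf (h w) x * indicator {..m} (w + \<beta> x w - \<mu>)) - indicator {..m} w"

lemma cdf_terminal_minus_cdf:
  assumes \<beta>: "\<And>x. x \<in> X \<Longrightarrow> \<beta> x \<in> B"
  shows "integrable F (excess \<beta> \<mu> m)"
    and "cdf (distr joint borel (terminal \<beta> \<mu>)) m - cdf F m = (\<integral>w. excess \<beta> \<mu> m w \<partial>F)"
proof -
  have T [measurable]: "terminal \<beta> \<mu> \<in> borel_measurable joint" using \<beta> by (rule terminal_measurable)
  have i: "integrable joint (\<lambda>z. indicator {..m} (terminal \<beta> \<mu> z) :: real)"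
    by (rule J.integrable_const_bound[of _ 1]) auto
  have iF: "integrable F (indicator {..m} :: real \<Rightarrow> real)"
    by (rule F.integrable_const_bound[of _ 1]) auto
  have iS: "integrable F (\<lambda>w. \<Sum>x\<in>X. pmf (h w) x * indicator {..m} (w + \<beta> x w - \<mu>))"
    using integral_joint(2)[OF i] by (intro Bochner_Integration.integrable_sum) (simp add: terminal_def)
  then show "integrable F (excess \<beta> \<mu> m)"
    unfolding excess_def[abs_def] using iF by (intro Bochner_Integration.integrable_diff)
  have "cdf (distr joint borel (terminal \<beta> \<mu>)) m = (\<integral>y. indicator {..m} y \<partial>distr joint borel (terminal \<beta> \<mu>))"
    by (simp add: cdf_def)
  also have "\<dots> = (\<integral>z. indicator {..m} (terminal \<beta> \<mu> z) \<partial>joint)"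
    by (rule integral_distr) auto
  also have "\<dots> = (\<Sum>x\<in>X. \<integral>w. pmf (h w) x * indicator {..m} (w + \<beta> x w - \<mu>) \<partial>F)"
    using integral_joint(1)[OF i] by (simp add: terminal_def)
  also have "\<dots> = (\<integral>w. (\<Sum>x\<in>X. pmf (h w) x * indicator {..m} (w + \<beta> x w - \<mu>)) \<partial>F)"
    using integral_joint(2)[OF i] by (intro Bochner_Integration.integral_sum[symmetric]) (simp add: terminal_def)
  finally have 1: "cdf (distr joint borel (terminal \<beta> \<mu>)) m =
    (\<integral>w. (\<Sum>x\<in>X. pmf (h w) x * indicator {..m} (w + \<beta> x w - \<mu>)) \<partial>F)" .
  have 2: "cdf F m = (\<integral>w. indicator {..m} w \<partial>F)" by (simp add: cdf_def)
  show "cdf (distr joint borel (terminal \<beta> \<mu>)) m - cdf F m = (\<integral>w. excess \<beta> \<mu> m w \<partial>F)"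
    unfolding excess_def[abs_def] 1 2 using iS iF by (rule Bochner_Integration.integral_diff[symmetric])
qed

text \<open>
  The substitution \<open>w = m + s\<close> makes the excess monotone in \<open>m\<close> for each fixed \<open>s\<close>.
\<close>

lemma cdf_terminal_minus_cdf_shifted:
  assumes \<beta>: "\<And>x. x \<in> X \<Longrightarrow> \<beta> x \<in> B"
  shows "integrable lborel (\<lambda>s. excess \<beta> \<mu> m (m + s) * f (m + s))"
    and "cdf (distr joint borel (terminal \<beta> \<mu>)) m - cdf F m =
      (\<integral>s. excess \<beta> \<mu> m (m + s) * f (m + s) \<partial>lborel)"
proof -
  have i: "integrable F (excess \<beta> \<mu> m)" using \<beta> by (rule cdf_terminal_minus_cdf(1))
  then have [measurable]: "excess \<beta> \<mu> m \<in> borel_measurable borel"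
    by (auto dest: borel_measurable_integrable)
  have i': "integrable lborel (\<lambda>w. excess \<beta> \<mu> m w * f w)"
    using i unfolding F_eq
    by (subst (asm) integrable_density) (auto simp: density_nonneg mult.commute)
  from lborel_integrable_real_affine[OF i', of 1 m]
  show "integrable lborel (\<lambda>s. excess \<beta> \<mu> m (m + s) * f (m + s))" by simp
  have "(\<integral>w. excess \<beta> \<mu> m w \<partial>F) = (\<integral>w. excess \<beta> \<mu> m w * f w \<partial>lborel)"
    unfolding F_eq by (subst integral_density) (auto simp: density_nonneg mult.commute)
  also have "\<dots> = (\<integral>s. excess \<beta> \<mu> m (m + s) * f (m + s) \<partial>lborel)"
    using lborel_integral_real_affine[of 1 "\<lambda>w. excess \<beta> \<mu> m w * f w" m] by simp
  finally show "cdf (distr joint borel (terminal \<beta> \<mu>)) m - cdf F m =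
      (\<integral>s. excess \<beta> \<mu> m (m + s) * f (m + s) \<partial>lborel)"
    using cdf_terminal_minus_cdf(2)[of \<beta> \<mu> m, OF \<beta>] by simp
qed

lemma sum_signals_indicator_le_1: "(\<Sum>x\<in>X. pmf (h w) x * indicator A (t x)) \<le> 1"
proof -
  have "(\<Sum>x\<in>X. pmf (h w) x * indicator A (t x)) \<le> (\<Sum>x\<in>X. pmf (h w) x)"
    by (intro sum_mono) (auto simp: indicator_def)
  then show ?thesis by (simp add: sum_signals)
qed

lemma excess_nonneg: "m < w \<Longrightarrow> 0 \<le> excess \<beta> \<mu> m w"
  by (auto simp: excess_def intro!: sum_nonneg)

lemma excess_nonpos: "w \<le> m \<Longrightarrow> excess \<beta> \<mu> m w \<le> 0"
  using sum_signals_indicator_le_1 by (simp add: excess_def)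

lemma excess_zero:
  assumes "m < w" "\<And>x. x \<in> X \<Longrightarrow> m < w + \<beta> x w - \<mu>"
  shows "excess \<beta> \<mu> m w = 0"
  using assms by (auto simp: excess_def indicator_def intro!: sum.neutral dest: assms(2))

text \<open>At w = m + s the event Y \<le> m says that the asset pays at most \<mu> - s, while the
  subtracted indicator depends on \<open>s\<close> alone. As \<open>m\<close> rises payments fall,
  so more signals qualify. These signals form an up-set, since below the pivot higher signals go
  with smaller payments, and MLR makes the up-set more likely at higher wealth.\<close>

lemma excess_mono:
  assumes \<beta>: "\<And>x. x \<in> X \<Longrightarrow> \<beta> x \<in> B"
    and dom: "\<And>x x'. x \<in> X \<Longrightarrow> x' \<in> X \<Longrightarrow> x \<le> x' \<Longrightarrow> dominates r (\<beta> x) (\<beta> x')"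
    and "m' \<le> m" "m + s \<le> r"
  shows "excess \<beta> \<mu> m' (m' + s) \<le> excess \<beta> \<mu> m (m + s)"
proof -
  define A where "A = {x \<in> X. s + \<beta> x (m + s) \<le> \<mu>}"
  have fA: "(\<Sum>x\<in>X. p x * indicator {..m} (m + s + \<beta> x (m + s) - \<mu>)) = sum p A" for p :: "real \<Rightarrow> real"
    by (rule sum.mono_neutral_cong_right) (auto simp: A_def finite_signals indicator_def)
  have "(\<Sum>x\<in>X. pmf (h (m' + s)) x * indicator {..m'} (m' + s + \<beta> x (m' + s) - \<mu>))
      \<le> (\<Sum>x\<in>X. pmf (h (m' + s)) x * indicator {..m} (m + s + \<beta> x (m + s) - \<mu>))"
  proof (intro sum_mono mult_left_mono)
    fix x assume "x \<in> X"
    then have "\<beta> x (m + s) \<le> \<beta> x (m' + s)"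
      using menu_antimono[OF \<beta>, of x "m' + s" "m + s"] \<open>m' \<le> m\<close> by simp
    then show "indicator {..m'} (m' + s + \<beta> x (m' + s) - \<mu>) \<le>
        (indicator {..m} (m + s + \<beta> x (m + s) - \<mu>) :: real)"
      by (auto simp: indicator_def)
  qed simp
  also have "\<dots> = sum (pmf (h (m' + s))) A" by (rule fA)
  also have "\<dots> \<le> sum (pmf (h (m + s))) A"
  proof (rule MLR_upset_dominance[OF finite_signals])
    fix x x' assume "x \<in> A" "x' \<in> X" "x \<le> x'"
    moreover from this have "\<beta> x' (m + s) \<le> \<beta> x (m + s)"
      using dom[of x x'] \<open>m + s \<le> r\<close> by (auto simp: dominates_def A_def)
    ultimately show "x' \<in> A" by (auto simp: A_def)
  qed (use sum_signals \<open>m' \<le> m\<close> in \<open>auto simp: A_def intro!: MLR\<close>)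
  also have "\<dots> = (\<Sum>x\<in>X. pmf (h (m + s)) x * indicator {..m} (m + s + \<beta> x (m + s) - \<mu>))"
    by (rule fA[symmetric])
  finally show ?thesis by (simp add: excess_def indicator_def)
qed

text \<open>Cross-multiplied monotonicity of the cdf difference divided by \<open>f\<close>, proved
  pointwise in \<open>s\<close>. For s > 0 the excess is nonnegative and the ratio f (m + s) / f m
  rises in \<open>m\<close>; for s \<le> 0 the excess is nonpositive and the ratio falls. In both
  cases the product rises.\<close>

lemma cdf_difference_ratio_mono:
  assumes \<mu>: "0 \<le> \<mu>" and \<beta>: "\<And>x. x \<in> X \<Longrightarrow> \<beta> x \<in> B"
    and dom: "\<And>x x'. x \<in> X \<Longrightarrow> x' \<in> X \<Longrightarrow> x \<le> x' \<Longrightarrow> dominates r (\<beta> x) (\<beta> x')"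
    and m: "m' \<le> m" "m < r - \<mu>"
  shows "f m * (cdf (distr joint borel (terminal \<beta> \<mu>)) m' - cdf F m') \<le>
    f m' * (cdf (distr joint borel (terminal \<beta> \<mu>)) m - cdf F m)"
proof -
  have eq: "cdf (distr joint borel (terminal \<beta> \<mu>)) l - cdf F l =
      (\<integral>s. excess \<beta> \<mu> l (l + s) * f (l + s) \<partial>lborel)" for l
    using \<beta> by (rule cdf_terminal_minus_cdf_shifted(2))
  show ?thesis
    unfolding eq integral_mult_right_zero[symmetric]
  proof (intro integral_mono integrable_mult_right cdf_terminal_minus_cdf_shifted(1) \<beta>)
    fix s
    let ?E' = "excess \<beta> \<mu> m' (m' + s)" and ?E = "excess \<beta> \<mu> m (m + s)"
    have f0: "0 \<le> f w" for w by (rule density_nonneg)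
    show "f m * (?E' * f (m' + s)) \<le> f m' * (?E * f (m + s))"
    proof (cases "m + s < r")
      case True
      have le: "?E' \<le> ?E" using \<beta> dom m True by (intro excess_mono) auto
      show ?thesis
      proof (cases "0 < s")
        case True
        have "f m * f (m' + s) \<le> f m' * f (m + s)"
          using density_ratio_mono[of m' m s] \<open>m + s < r\<close> True m by simp
        from mult_mono[OF le this] have "?E' * (f m * f (m' + s)) \<le> ?E * (f m' * f (m + s))"
          using excess_nonneg[of m "m + s" \<beta> \<mu>] True f0 by simp
        then show ?thesis by (simp add: mult_ac)
      next
        case False
        have ratio: "f m' * f (m + s) \<le> f m * f (m' + s)"
          using density_ratio_mono[of "m' + s" "m + s" "- s"] m \<mu> False by (simp add: mult.commute)
        have "?E' * (f m * f (m' + s)) \<le> ?E * (f m * f (m' + s))"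
          using le f0 by (intro mult_right_mono) auto
        also have "\<dots> \<le> ?E * (f m' * f (m + s))"
          using ratio excess_nonpos[of "m + s" m \<beta> \<mu>] False by (intro mult_left_mono_neg) auto
        finally show ?thesis by (simp add: mult_ac)
      qed
    next
      case False
      \<comment> \<open>Here s > \<mu>. If \<open>l + s\<close> is below the pivot, the payment is
        nonnegative and terminal wealth exceeds \<open>l\<close>; otherwise it is at least r -
        \<mu>, which exceeds \<open>m\<close>.\<close>
      have zero: "excess \<beta> \<mu> l (l + s) = 0" if "l \<le> m" for l
      proof (rule excess_zero)
        show "l < l + s" using False m \<mu> by simp
        show "l < l + s + \<beta> x (l + s) - \<mu>" if "x \<in> X" for x
          using asset_nonneg[OF \<beta>[OF that], of "l + s"] wealth_above_pivot[OF \<beta>[OF that], of "l + s"]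
            False m \<open>l \<le> m\<close> by (cases "l + s \<le> r") auto
      qed
      show ?thesis using zero[of m] zero[of m'] m(1) by simp
    qed
  qed
qed

text \<open>If background wealth is at most \<open>m\<close>, so is terminal wealth: below the pivot
  insurance raises wealth to \<open>r\<close> at most and r - \<mu> \<le> m, while above it both the
  payment and the price lower wealth.\<close>

lemma cdf_le_cdf_terminal:
  assumes \<mu>: "0 \<le> \<mu>" and \<beta>: "\<And>x. x \<in> X \<Longrightarrow> \<beta> x \<in> B" and m: "r - \<mu> \<le> m"
  shows "cdf F m \<le> cdf (distr joint borel (terminal \<beta> \<mu>)) m"
proof -
  have "0 \<le> excess \<beta> \<mu> m w" for w
  proof (cases "w \<le> m")
    case True
    have "w + \<beta> x w - \<mu> \<le> m" if "x \<in> X" for x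
      using menu_wealth_mono[OF \<beta>[OF that], of w r] asset_pivot[OF \<beta>[OF that]]
        asset_nonpos[OF \<beta>[OF that], of w] m \<mu> True by (cases "w \<le> r") auto
    then have "(\<Sum>x\<in>X. pmf (h w) x * indicator {..m} (w + \<beta> x w - \<mu>)) = (\<Sum>x\<in>X. pmf (h w) x)"
      by (intro sum.cong) auto
    then show ?thesis using True by (simp add: excess_def sum_signals)
  qed (simp add: excess_nonneg)
  then have "0 \<le> (\<integral>w. excess \<beta> \<mu> m w \<partial>F)" by (intro integral_nonneg_AE) auto
  then show ?thesis using cdf_terminal_minus_cdf(2)[of \<beta> \<mu> m, OF \<beta>] by simp
qed

section \<open>Comparison of the two utilities\<close>

lemma expected_utility_comparison:
  assumes u: "u \<in> utilities F" and v: "v \<in> utilities F" and ra: "more_risk_averse u v"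
    and \<mu>: "0 \<le> \<mu>" and \<beta>: "\<And>x. x \<in> X \<Longrightarrow> \<beta> x \<in> B"
    and dom: "\<And>x x'. x \<in> X \<Longrightarrow> x' \<in> X \<Longrightarrow> x \<le> x' \<Longrightarrow> dominates r (\<beta> x) (\<beta> x')"
    and less: "(\<integral>w. v w \<partial>F) < (\<integral>z. v (terminal \<beta> \<mu> z) \<partial>joint)"
  shows "(\<integral>w. u w \<partial>F) \<le> (\<integral>z. u (terminal \<beta> \<mu> z) \<partial>joint)"
proof -
  let ?G = "distr joint borel (terminal \<beta> \<mu>)"
  have T [measurable]: "terminal \<beta> \<mu> \<in> borel_measurable joint" using \<beta> by (rule terminal_measurable)
  have G: "real_distribution ?G" using \<beta> by (rule real_distribution_terminal)
  note F = F.real_distribution_axioms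
  have meas [measurable]: "u \<in> borel_measurable borel" "v \<in> borel_measurable borel"
    using u v by (auto intro: utility_measurable)
  have int: "integrable ?G u" "integrable ?G v"
    using integrable_expected_utility[of _ \<mu> \<beta>, OF _ \<mu> \<beta>] u v by (auto simp: integrable_distr_eq)
  have eq: "integral\<^sup>L ?G u = (\<integral>z. u (terminal \<beta> \<mu> z) \<partial>joint)"
    "integral\<^sup>L ?G v = (\<integral>z. v (terminal \<beta> \<mu> z) \<partial>joint)" by (auto intro: integral_distr)
  have iF: "integrable F u" "integrable F v" "mono v"
    using u v by (auto simp: utilities_def strict_mono_mono)
  define N where "N = {m. m < r - \<mu> \<and> cdf ?G m < cdf F m}"
  have ge: "cdf F m \<le> cdf ?G m" if "m \<notin> N" for m
    using that cdf_le_cdf_terminal[of \<mu> \<beta> m, OF \<mu> \<beta>] by (cases "m < r - \<mu>") (auto simp: N_def)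
  \<comment> \<open>If \<open>N\<close> were empty, background wealth would first-order dominate
    terminal wealth, against the strict preference of \<open>v\<close>. So \<open>Sup N\<close>
    exists and serves as the crossing point.\<close>
  have "N \<noteq> {}"
  proof
    assume "N = {}"
    then have "ext_integral ?G v \<le> ext_integral F v"
      using ge utility_continuous[OF v] iF(3) by (intro ext_integral_mono_fosd[OF G F]) auto
    then show False using less iF(2) int(2) eq(2) by (simp add: ext_integral_eq_integral)
  qed
  have bdd: "bdd_above N" by (auto simp: N_def bdd_above_def intro: less_imp_le)
  obtain \<phi> where \<phi>: "strict_mono \<phi>" "concave_on UNIV \<phi>" "u = \<phi> \<circ> v"
    using ra by (auto simp: more_risk_averse_def)
  have "integral\<^sup>L F u \<le> integral\<^sup>L ?G u"
  proof (rule integral_concave_single_crossing[OF G F utility_continuous[OF v] iF(3)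
        utility_continuous[OF u] \<phi>(3,1,2) int(2) iF(2) int(1) iF(1)])
    fix y assume "y < Sup N"
    then obtain m where m: "m \<in> N" "y < m" using less_cSup_iff[OF \<open>N \<noteq> {}\<close> bdd] by auto
    then have m': "m < r - \<mu>" "cdf ?G m - cdf F m < 0" by (auto simp: N_def)
    \<comment> \<open>A negative difference at a point of \<open>N\<close> forces a nonpositive one
      at every point to its left.\<close>
    have "f m * (cdf ?G y - cdf F y) \<le> f y * (cdf ?G m - cdf F m)"
      using \<mu> \<beta> dom m m' by (intro cdf_difference_ratio_mono) auto
    also have "\<dots> \<le> 0" using density_nonneg m'(2) by (intro mult_nonneg_nonpos) auto
    finally show "cdf ?G y \<le> cdf F y"
      using density_pos[of m] m'(1) \<mu> by (auto simp: mult_le_0_iff)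
  next
    fix y assume "Sup N < y"
    then have "y \<notin> N" using cSup_upper[OF _ bdd] by force
    then show "cdf F y \<le> cdf ?G y" by (rule ge)
  qed (use less eq in auto)
  then show ?thesis by (simp add: eq)
qed

lemma WTP_increasing:
  assumes u: "u \<in> utilities F" and v: "v \<in> utilities F" and ra: "more_risk_averse u v"
  shows "WTP F f B X h v \<le> WTP F f B X h u"
proof (rule ccontr)
  assume "\<not> ?thesis"
  then obtain \<mu> where \<mu>: "WTP F f B X h u < \<mu>" "\<mu> < WTP F f B X h v" using dense by (auto simp: not_le)
  then have \<mu>0: "0 \<le> \<mu>" using WTP_characterization(1)[OF u] by simp
  obtain \<beta> where \<beta>: "\<And>x. x \<in> X \<Longrightarrow> \<beta> x \<in> B"
    and lt: "ext_integral F v < ext_integral joint (\<lambda>z. v (terminal \<beta> \<mu> z))"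
    using less_V_obtain[OF v WTP_characterization(3)[OF v \<mu>0 \<mu>(2)]] by metis
  have "(\<integral>w. v w \<partial>F) < (\<integral>z. v (terminal \<beta> \<mu> z) \<partial>joint)"
    using lt integrable_expected_utility[of v \<mu> \<beta>, OF v \<mu>0 \<beta>]
    by (simp add: ext_integral_utility[OF v] ext_integral_eq_integral)
  moreover obtain \<gamma> where \<gamma>: "\<And>x. x \<in> X \<Longrightarrow> \<gamma> x \<in> B"
    "\<And>x x'. x \<in> X \<Longrightarrow> x' \<in> X \<Longrightarrow> x \<le> x' \<Longrightarrow> dominates r (\<gamma> x) (\<gamma> x')"
    "(\<integral>z. v (terminal \<beta> \<mu> z) \<partial>joint) \<le> (\<integral>z. v (terminal \<gamma> \<mu> z) \<partial>joint)"
    using monotone_strategy[of v \<mu> \<beta>, OF v \<mu>0 \<beta>] by blast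
  ultimately have "(\<integral>w. u w \<partial>F) \<le> (\<integral>z. u (terminal \<gamma> \<mu> z) \<partial>joint)"
    by (intro expected_utility_comparison[OF u v ra \<mu>0]) auto
  then have "ext_integral F u \<le> ext_integral joint (\<lambda>z. u (terminal \<gamma> \<mu> z))"
    using integrable_expected_utility[of u \<mu> \<gamma>, OF u \<mu>0 \<gamma>(1)]
    by (simp add: ext_integral_utility[OF u] ext_integral_eq_integral)
  also have "\<dots> \<le> V u \<mu>" using u \<gamma>(1) by (rule le_V)
  finally show False using WTP_characterization(2)[OF u \<mu>(1)] by simp
qed

end

theorem theorem2:
  fixes F :: "real measure" and f :: "real \<Rightarrow> real" and B :: "(real \<Rightarrow> real) set"
    and X :: "real set" and h :: "real \<Rightarrow> real pmf" and u v :: "real \<Rightarrow> real"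
  assumes "background_risk F f" and "asset_menu F B" and "MLR_experiment F X h"
    and "downward_log_convex f" and "insurance_menu F B"
    and "u \<in> utilities F" and "v \<in> utilities F"
    and "more_risk_averse u v"
    and "ZAZI F B u" and "ZAZI F B v"
  shows "WTP F f B X h u \<ge> WTP F f B X h v"
proof -
  interpret information_environment F f B X h
    using assms by unfold_locales
  show ?thesis
  proof (cases rule: insurance_pivot_cases)
    case degenerate
    \<comment> \<open>By (ZAZI) for \<open>v\<close> the nonnegative assets are null, so no asset
      improves on the status quo and \<open>v\<close> pays nothing.\<close>
    have nonpos: "AE w in F. b w \<le> 0" if b: "b \<in> B" for b
    proof (cases "AE w in F. 0 \<le> b w")
      case True
      from ZAZI_nonneg_asset_null[OF assms(7,10) b True] show ?thesis by eventually_elim simp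
    qed (use degenerate[OF b] in blast)
    have "WTP F f B X h v \<le> 0"
    proof (rule ccontr)
      assume "\<not> ?thesis"
      then show False
        using WTP_characterization(3)[OF assms(7), of 0] V_le_of_nonpositive_menu[OF assms(7), of 0] nonpos
        by force
    qed
    then show ?thesis using WTP_characterization(1)[OF assms(6)] by simp
  next
    case (pivot r)
    then interpret pivotal_environment F f B X h r by unfold_locales
    show ?thesis using assms(6-8) by (rule WTP_increasing)
  qed
qed

end
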